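(* Let $A$ be an expansive $d\times d$ integer matrix, let $\mathcal D\subset\mathbb Z^d$ be a complete set of representatives for $\mathbb Z^d/A^T\mathbb Z^d$, and let $C=\{\theta_0,\dots,\theta_{p-1}\}\subset\mathbb R^d$ be a simple cycle for $(\tau_d)_{d\in\mathcal D}$. (i) For each $k\in\mathbb Z^d$ and each $j\in\mathbb Z_p$ there is a unique $\omega(k,j)=\omega_0\omega_1\dots\in\Omega$ such that for all $x\in\mathbb R^d$, $$(e^{2\pi i x},e^{2\pi i\tau_{\omega_0}x},e^{2\pi i\tau_{\omega_1}\tau_{\omega_0}x},\dots)=\hat i_C(x+k-\theta_j,j)=\sigma_A^{-j}(\chi_C)\,\hat i(x+k-\theta_j)=\bigl(e^{2\pi i((A^T)^{-n}(x+k-\theta_j)+\theta_{j+n})}\bigr)_{n\in\mathbb N}.$$ Moreover there exists a cycle $C'\subset (C-\mathbb Z^d)\cap X(A^T,\mathcal D)$ such that $\omega(k,j)\in\Omega_{C'}$. (ii) The infinite word $\omega(k,j)=\omega_0\omega_1\dots$ can be constructed as follows: $$\omega_n=\mathcal R_C^n(k-\theta_j)-A^T\mathcal R_C^{n+1}(k-\theta_j)\qquad(n\in\mathbb N).$$ (iii) Suppose $C'$ is a cycle contained in $(C-\mathbb Z^d)\cap X(A^T,\mathcal D)$ and $\omega=\omega_0\omega_1\dots\in\Omega_{C'}$. Then there is a unique $(k(\omega),j(\omega))\in\mathbb Z^d\times\mathbb Z_p$ such that for all $x\in\mathbb R^d$, $$(e^{2\pi i x},e^{2\pi i\tau_{\omega_0}x},e^{2\pi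 i\tau_{\omega_1}\tau_{\omega_0}x},\dots)=\hat i_C(x+k(\omega)-\theta_{j(\omega)},j(\omega)).$$ (iv) $(k(\omega),j(\omega))$ can be constructed as follows: if $\omega\in\Omega_{C'}$ has the form $\omega_0\dots\omega_{np-1}\underline{m_0\dots m_{q-1}}$ (with $m_0\dots m_{q-1}$ a word to which the cycle $C'$ is associated), then the fixed point $\eta_0$ of $\tau_{m_{q-1}}\cdots\tau_{m_0}$ belongs to $\theta_{j(\omega)}-\mathbb Z^d$ for some unique $j(\omega)\in\mathbb Z_p$, and $$k(\omega)=\omega_0+A^T\omega_1+\dots+(A^T)^{np-1}\omega_{np-1}+\theta_{j(\omega)}-(A^T)^{np}\eta_0.$$ (v) Let $\tilde\Omega_C:=\bigcup\{\Omega_{C'} : C'\text{ a cycle in }(C-\mathbb Z^d)\cap X(A^T,\mathcal D)\}$. The maps $$\mathfrak e_C:\mathbb Z^d\times\mathbb Z_p\to\tilde\Omega_C,\ \mathfrak e_C(k,j)=\omega(k,j),\qquad \mathfrak d_C:\tilde\Omega_C\to\mathbb Z^d\times\mathbb Z_p,\ \mathfrak d_C(\omega)=(k(\omega),j(\omega))$$ are inverse to each other.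
   Context: $\mathbb N=\{0,1,2,\dots\}$. An integer matrix $A$ is expansive if all its eigenvalues $\lambda$ satisfy $|\lambda|>1$; $A^T$ is the transpose. For $x\in\mathbb R^d$, $e^{2\pi i x}:=(e^{2\pi i x_1},\dots,e^{2\pi i x_d})\in\mathbb T^d$; for $z=e^{2\pi i x}\in\mathbb T^d$ put $z^A:=e^{2\pi i A^Tx}$. The solenoid is the compact abelian group $\mathcal S_A=\{(z_n)_{n\in\mathbb N}: z_n\in\mathbb T^d,\ z_{n+1}^A=z_n \text{ for all } n\in\mathbb N\}$ with coordinatewise multiplication, and $\sigma_A(z_0,z_1,\dots)=(z_0^A,z_0,z_1,\dots)$ is an automorphism of it. The map $\hat i:\mathbb R^d\to\mathcal S_A$ is $\hat i(x)=(e^{2\pi i(A^T)^{-n}x})_{n\in\mathbb N}$. For $d\in\mathcal D$, $\tau_d(x)=(A^T)^{-1}(x+d)$ on $\mathbb R^d$. $\Omega=\mathcal D^{\mathbb N}$ is the set of infinite words in the alphabet $\mathcal D$. $X(A^T,\mathcal D)=\{\sum_{j\ge1}(A^T)^{-j}d_j : d_j\in\mathcal D\}$ is the attractor of $(\tau_d)_{d\in\mathcal D}$. $\underline{w}$ denotes the infinite repetition of a finite word $w$. A finite set $C=\{\theta_0,\dots,\theta_{p-1}\}\subset\mathbb R^d$ is a cycle (associated to the word $l_0\dots l_{p-1}$, $l_i\in\mathcal D$) if $\tau_{l_0}\theta_0=\theta_1,\dots,\tau_{l_{p-2}}\theta_{p-2}=\theta_{p-1}$, $\tau_{l_{p-1}}\theta_{p-1}=\theta_0$;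 thus $\theta_0$ is the fixed point of $\tau_{l_{p-1}}\cdots\tau_{l_0}$. It is simple if $\theta_j\not\equiv\theta_{j'}\bmod\mathbb Z^d$ for $j\ne j'$. Indices of $\theta$ are read modulo $p$, and $\mathbb Z_p$ is the cyclic group of order $p$. For a cycle $C'$ associated to $m_0\dots m_{q-1}$, $\Omega_{C'}\subset\Omega$ is the set of infinite words that end in $\underline{m_0\dots m_{q-1}}$, i.e. words $\omega_0\dots\omega_n\underline{m_0\dots m_{q-1}}$ with $n\in\mathbb N$, $\omega_i\in\mathcal D$. $C-\mathbb Z^d=\{\theta_j-k: 0\le j<p,\ k\in\mathbb Z^d\}$ and $\mathbb Z^d-C=\{k-\theta_j\}$. $\chi_C:=(e^{2\pi i\theta_n})_{n\in\mathbb N}\in\mathcal S_A$, and $\hat i_C(x,j):=\sigma_A^{-j}(\chi_C)\hat i(x)=(e^{2\pi i((A^T)^{-n}x+\theta_{n+j})})_{n\in\mathbb N}$ for $x\in\mathbb R^d$, $j\in\mathbb Z_p$. For a simple cycle $C$, the map $\mathcal R_C:\mathbb Z^d-C\to\mathbb Z^d-C$ is defined as follows: for $a\in\mathbb Z^d$ and $j\in\{0,\dots,p-1\}$ there exist unique $b\in\mathbb Z^d$ and $d_0\in\mathcal D$ with $a-\theta_j=A^T(b-\theta_{j+1})+d_0$, and $\mathcal R_C(a-\theta_j):=b-\theta_{j+1}$. *)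

theory Defs
  imports "HOL-Analysis.Analysis"
begin

text \<open>
  Since \<open>*\<close> and \<open>^\<close> are componentwise on the vector types \<open>_ ^ 'd\<close>, a power of a matrix
  acting on a vector is written as an iterate of \<open>(*v) M\<close>.
\<close>

definition expansive :: "int^'d^'d \<Rightarrow> bool" where
  "expansive A \<longleftrightarrow>
     (\<forall>(\<mu>::complex) v. v \<noteq> 0 \<and> map_matrix of_int A *v v = \<mu> *s v \<longrightarrow> cmod \<mu> > 1)"

definition lattice :: "(real^'d) set" where
  "lattice = {x. \<forall>i. x $ i \<in> \<int>}"

definition AT :: "int^'d^'d \<Rightarrow> real^'d^'d" where
  "AT A = map_matrix real_of_int (transpose A)"

abbreviation AT_pow :: "int^'d^'d \<Rightarrow> nat \<Rightarrow> real^'d \<Rightarrow> real^'d" where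
  "AT_pow A n \<equiv> (*v) (AT A) ^^ n"

abbreviation AT_inv_pow :: "int^'d^'d \<Rightarrow> nat \<Rightarrow> real^'d \<Rightarrow> real^'d" where
  "AT_inv_pow A n \<equiv> (*v) (matrix_inv (AT A)) ^^ n"

definition complete_reps :: "int^'d^'d \<Rightarrow> (real^'d) set \<Rightarrow> bool" where
  "complete_reps A D \<longleftrightarrow>
     D \<subseteq> lattice \<and> (\<forall>k\<in>lattice. \<exists>!d. d \<in> D \<and> k - d \<in> (*v) (AT A) ` lattice)"

section \<open>The torus and the solenoid\<close>

definition torus :: "(complex^'d) set" where
  "torus = {z. \<forall>i. cmod (z $ i) = 1}"

definition torus_exp :: "real^'d \<Rightarrow> complex^'d" where
  "torus_exp x = (\<chi> i. exp (2 * complex_of_real pi * \<i> * complex_of_real (x $ i)))"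

text \<open>The value does not depend on the logarithm \<open>x\<close>; see \<open>torus_pow_torus_exp\<close>.\<close>

definition torus_pow :: "complex^'d \<Rightarrow> int^'d^'d \<Rightarrow> complex^'d" where
  "torus_pow z A = (THE w. \<exists>x. z = torus_exp x \<and> w = torus_exp (AT A *v x))"

lemma torus_exp_eq_iff: "torus_exp x = torus_exp y \<longleftrightarrow> x - y \<in> lattice"
proof -
  have "exp (2 * complex_of_real pi * \<i> * complex_of_real s)
          = exp (2 * complex_of_real pi * \<i> * complex_of_real t) \<longleftrightarrow> s - t \<in> \<int>" for s t :: real
  proof -
    have "exp (2 * complex_of_real pi * \<i> * complex_of_real s)
            = exp (2 * complex_of_real pi * \<i> * complex_of_real t) \<longleftrightarrow>
          (\<exists>n::int. 2 * pi * s = 2 * pi * t + of_int (2 * n) * pi)"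
      by (subst exp_eq) (auto simp: complex_eq_iff)
    also have "\<dots> \<longleftrightarrow> (\<exists>n::int. s - t = of_int n)"
    proof -
      have "2 * pi * s = 2 * pi * t + of_int (2 * n) * pi \<longleftrightarrow> s - t = of_int n" for n :: int
      proof -
        have "2 * pi * s = 2 * pi * t + of_int (2 * n) * pi \<longleftrightarrow>
              (2 * pi) * (s - t) = (2 * pi) * of_int n"
          by (auto simp: algebra_simps)
        then show ?thesis by simp
      qed
      then show ?thesis by simp
    qed
    finally show ?thesis by (auto simp: Ints_def)
  qed
  then show ?thesis by (simp add: torus_exp_def lattice_def vec_eq_iff)
qed

lemma AT_lattice: "x \<in> lattice \<Longrightarrow> AT A *v x \<in> lattice"
  by (auto simp: lattice_def AT_def matrix_vector_mult_def map_matrix_def transpose_def)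

lemma torus_pow_torus_exp: "torus_pow (torus_exp x) A = torus_exp (AT A *v x)"
  unfolding torus_pow_def
proof (rule the_equality)
  fix w assume "\<exists>y. torus_exp x = torus_exp y \<and> w = torus_exp (AT A *v y)"
  then obtain y where y: "torus_exp x = torus_exp y" "w = torus_exp (AT A *v y)" by blast
  from y(1) have "AT A *v (x - y) \<in> lattice" by (simp add: torus_exp_eq_iff AT_lattice)
  then have "torus_exp (AT A *v x) = torus_exp (AT A *v y)"
    by (simp add: torus_exp_eq_iff matrix_vector_mult_diff_distrib)
  with y(2) show "w = torus_exp (AT A *v x)" by simp
qed blast

definition solenoid :: "int^'d^'d \<Rightarrow> (nat \<Rightarrow> complex^'d) set" where
  "solenoid A = {z. \<forall>n. z n \<in> torus \<and> torus_pow (z (Suc n)) A = z n}"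

definition solenoid_mult :: "(nat \<Rightarrow> complex^'d) \<Rightarrow> (nat \<Rightarrow> complex^'d) \<Rightarrow> nat \<Rightarrow> complex^'d" where
  "solenoid_mult z w = (\<lambda>n. z n * w n)"

definition sigma :: "int^'d^'d \<Rightarrow> (nat \<Rightarrow> complex^'d) \<Rightarrow> nat \<Rightarrow> complex^'d" where
  "sigma A z = case_nat (torus_pow (z 0) A) z"

definition sigma_inv :: "int^'d^'d \<Rightarrow> (nat \<Rightarrow> complex^'d) \<Rightarrow> nat \<Rightarrow> complex^'d" where
  "sigma_inv A = inv_into (solenoid A) (sigma A)"

lemma torus_exp_in_torus: "torus_exp x \<in> torus"
  by (simp add: torus_def torus_exp_def)

lemma torus_eq_range: "torus = range torus_exp"
proof (intro equalityI subsetI)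
  fix z :: "complex^'d" assume z: "z \<in> torus"
  have "z = torus_exp (\<chi> i. Arg (z $ i) / (2 * pi))"
  proof -
    have "exp (\<i> * complex_of_real (Arg (z $ i))) = z $ i" for i
    proof -
      have "cmod (z $ i) = 1" using z by (simp add: torus_def)
      then have "z $ i \<noteq> 0" by auto
      then show ?thesis using Arg_eq[of "z $ i"] \<open>cmod (z $ i) = 1\<close> by simp
    qed
    then show ?thesis by (simp add: torus_exp_def vec_eq_iff mult.commute)
  qed
  then show "z \<in> range torus_exp" by blast
qed (auto simp: torus_exp_in_torus)

lemma torus_pow_in_torus: "z \<in> torus \<Longrightarrow> torus_pow z A \<in> torus"
  by (auto simp: torus_eq_range torus_pow_torus_exp)

lemma sigma_bij: "bij_betw (sigma A) (solenoid A) (solenoid A)"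
proof (rule bij_betw_byWitness[where f' = "\<lambda>z n. z (Suc n)"])
  show "\<forall>z\<in>solenoid A. (\<lambda>n. sigma A z (Suc n)) = z" by (simp add: sigma_def)
  show "\<forall>z\<in>solenoid A. sigma A (\<lambda>n. z (Suc n)) = z"
    by (auto simp: sigma_def solenoid_def fun_eq_iff split: nat.split)
  show "sigma A ` solenoid A \<subseteq> solenoid A"
    by (auto simp: sigma_def solenoid_def torus_pow_in_torus split: nat.split)
  show "(\<lambda>z n. z (Suc n)) ` solenoid A \<subseteq> solenoid A"
    by (auto simp: solenoid_def)
qed

definition i_hat :: "int^'d^'d \<Rightarrow> real^'d \<Rightarrow> nat \<Rightarrow> complex^'d" where
  "i_hat A x = (\<lambda>n. torus_exp (AT_inv_pow A n x))"

section \<open>The iterated function system\<close>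

definition tau :: "int^'d^'d \<Rightarrow> real^'d \<Rightarrow> real^'d \<Rightarrow> real^'d" where
  "tau A d x = matrix_inv (AT A) *v (x + d)"

definition infinite_words :: "(real^'d) set \<Rightarrow> (nat \<Rightarrow> real^'d) set" where
  "infinite_words D = {\<omega>. \<forall>n. \<omega> n \<in> D}"

definition attractor :: "int^'d^'d \<Rightarrow> (real^'d) set \<Rightarrow> (real^'d) set" where
  "attractor A D = {x. \<exists>d\<in>infinite_words D. (\<lambda>j. AT_inv_pow A (Suc j) (d j)) sums x}"

text \<open>
  \<open>fold (tau A) [w\<^sub>0, \<dots>, w\<^sub>n] x = \<tau>\<^bsub>w\<^sub>n\<^esub> (\<dots> (\<tau>\<^bsub>w\<^sub>0\<^esub> x))\<close>.
\<close>

definition word_path :: "int^'d^'d \<Rightarrow> (nat \<Rightarrow> real^'d) \<Rightarrow> real^'d \<Rightarrow> nat \<Rightarrow> complex^'d" where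
  "word_path A \<omega> x = (\<lambda>n. torus_exp (fold (tau A) (map \<omega> [0..<n]) x))"

section \<open>Cycles\<close>

text \<open>
  A cycle is listed as \<open>\<theta> = [\<theta>\<^sub>0, \<dots>, \<theta>\<^bsub>p-1\<^esub>]\<close>, and \<open>\<int>\<^sub>p\<close> is represented by \<open>{..<p}\<close>.
  The points of a cycle that is not assumed simple may repeat in the list.
\<close>

definition cycle_list :: "int^'d^'d \<Rightarrow> (real^'d) set \<Rightarrow> (real^'d) list \<Rightarrow> (real^'d) list \<Rightarrow> bool" where
  "cycle_list A D \<theta> l \<longleftrightarrow> \<theta> \<noteq> [] \<and> length l = length \<theta> \<and> set l \<subseteq> D \<and>
     (\<forall>i<length \<theta>. tau A (l ! i) (\<theta> ! i) = \<theta> ! (Suc i mod length \<theta>))"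

definition simple_cycle :: "int^'d^'d \<Rightarrow> (real^'d) set \<Rightarrow> (real^'d) list \<Rightarrow> bool" where
  "simple_cycle A D \<theta> \<longleftrightarrow> (\<exists>l. cycle_list A D \<theta> l) \<and>
     (\<forall>i<length \<theta>. \<forall>j<length \<theta>. i \<noteq> j \<longrightarrow> \<theta> ! i - \<theta> ! j \<notin> lattice)"

definition associated :: "int^'d^'d \<Rightarrow> (real^'d) set \<Rightarrow> (real^'d) set \<Rightarrow> (real^'d) list \<Rightarrow> bool" where
  "associated A D C m \<longleftrightarrow> (\<exists>\<eta>. set \<eta> = C \<and> cycle_list A D \<eta> m)"

definition cycle_set :: "int^'d^'d \<Rightarrow> (real^'d) set \<Rightarrow> (real^'d) set \<Rightarrow> bool" where
  "cycle_set A D C \<longleftrightarrow> (\<exists>m. associated A D C m)"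

text \<open>
  The words that end in the infinite repetition of a word to which the cycle is associated.
  For the cycles \<open>C \<subseteq> set \<theta> - lattice\<close>, \<open>\<theta>\<close> a simple cycle, each point of \<open>C\<close> is mapped into
  \<open>set \<theta> - lattice\<close> by only one \<open>\<tau>\<^sub>d\<close>, so that word is unique up to rotation and repetition,
  neither of which affects the set below.
\<close>

definition Omega_cycle :: "int^'d^'d \<Rightarrow> (real^'d) set \<Rightarrow> (real^'d) set \<Rightarrow> (nat \<Rightarrow> real^'d) set" where
  "Omega_cycle A D C = {\<omega>\<in>infinite_words D.
     \<exists>m n. associated A D C m \<and> (\<forall>i. \<omega> (Suc n + i) = m ! (i mod length m))}"

definition minus_lattice :: "(real^'d) set \<Rightarrow> (real^'d) set" where
  "minus_lattice C = {c - k |c k. c \<in> C \<and> k \<in> lattice}"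

definition Omega_tilde :: "int^'d^'d \<Rightarrow> (real^'d) set \<Rightarrow> (real^'d) list \<Rightarrow> (nat \<Rightarrow> real^'d) set" where
  "Omega_tilde A D \<theta> =
     \<Union> {Omega_cycle A D C' |C'. cycle_set A D C' \<and> C' \<subseteq> minus_lattice (set \<theta>) \<inter> attractor A D}"

definition chi_cycle :: "(real^'d) list \<Rightarrow> nat \<Rightarrow> complex^'d" where
  "chi_cycle \<theta> = (\<lambda>n. torus_exp (\<theta> ! (n mod length \<theta>)))"

definition i_hat_cycle :: "int^'d^'d \<Rightarrow> (real^'d) list \<Rightarrow> real^'d \<Rightarrow> nat \<Rightarrow> nat \<Rightarrow> complex^'d" where
  "i_hat_cycle A \<theta> x j = solenoid_mult ((sigma_inv A ^^ j) (chi_cycle \<theta>)) (i_hat A x)"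

definition R_cycle :: "int^'d^'d \<Rightarrow> (real^'d) set \<Rightarrow> (real^'d) list \<Rightarrow> real^'d \<Rightarrow> real^'d" where
  "R_cycle A D \<theta> y = (THE y'. \<exists>a\<in>lattice. \<exists>j<length \<theta>. \<exists>b\<in>lattice. \<exists>d\<in>D.
     y = a - \<theta> ! j \<and> y' = b - \<theta> ! (Suc j mod length \<theta>) \<and>
     a - \<theta> ! j = AT A *v (b - \<theta> ! (Suc j mod length \<theta>)) + d)"

definition encode :: "int^'d^'d \<Rightarrow> (real^'d) set \<Rightarrow> (real^'d) list \<Rightarrow> (real^'d) \<times> nat \<Rightarrow> nat \<Rightarrow> real^'d" where
  "encode A D \<theta> = (\<lambda>(k, j). THE \<omega>. \<omega> \<in> infinite_words D \<and>
     (\<forall>x. word_path A \<omega> x = i_hat_cycle A \<theta> (x + k - \<theta> ! j) j))"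

definition decode :: "int^'d^'d \<Rightarrow> (real^'d) list \<Rightarrow> (nat \<Rightarrow> real^'d) \<Rightarrow> (real^'d) \<times> nat" where
  "decode A \<theta> \<omega> = (THE kj. case kj of (k, j) \<Rightarrow> k \<in> lattice \<and> j < length \<theta> \<and>
     (\<forall>x. word_path A \<omega> x = i_hat_cycle A \<theta> (x + k - \<theta> ! j) j))"

end

theory Submission
  imports Defs "HOL-Computational_Algebra.Fundamental_Theorem_Algebra"
begin

text \<open>
  Write \<open>B = A\<^sup>T\<close> and \<open>M = B\<^sup>-\<^sup>1\<close>. All maps \<open>\<tau>\<^sub>d\<close> have the linear part \<open>M\<close>, so along a word the
  difference of two orbits after \<open>n\<close> steps is \<open>M\<^sup>n\<close> applied to the difference of their starting
  points (\<open>word_orbit_diff\<close>). Comparing the orbit of \<open>x\<close> with that of \<open>\<theta>\<^sub>j - k\<close>, the identity between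
  the orbit of \<open>e\<^bsup>2\<pi>ix\<^esup>\<close> and the embedded line through \<open>\<sigma>\<^bsup>-j\<^esup>(\<chi>\<^sub>C)\<close> loses its dependence on \<open>x\<close>: it says
  precisely that the orbit of \<open>\<theta>\<^sub>j - k\<close> lies in the coset \<open>\<theta>\<^bsub>j+n\<^esub> + \<int>\<^sup>d\<close> at each time \<open>n\<close>
  (\<open>word_path_eq_iff\<close>; the predicate \<open>follows\<close>). Everything is then a statement about orbits that run
  through the cosets of the cycle in their cyclic order.

  From a point of \<open>\<theta>\<^sub>n + \<int>\<^sup>d\<close> exactly one digit leads into \<open>\<theta>\<^bsub>n+1\<^esub> + \<int>\<^sup>d\<close>, because the digits represent
  \<open>\<int>\<^sup>d / B\<int>\<^sup>d\<close> (\<open>unique_digit\<close>). Hence the starting point determines the word, and up to a change of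
  sign this forced step is the map \<open>\<R>\<^sub>C\<close>. The orbit is bounded, since \<open>M\<close> is contracting and there are
  only finitely many digits, and it stays in a discrete set. So it is eventually periodic, and its
  periodic part is the cycle in which the word ends (\<open>R_word_eventually_cyclic\<close>).

  Conversely, if a word ends in the word of a cycle inside the cosets, then the orbit can be read
  backwards from the cycle. The inverse of \<open>\<tau>\<^sub>d\<close> is \<open>y \<mapsto> By - d\<close>; it maps the coset of \<open>\<theta>\<^bsub>n+1\<^esub>\<close> into that
  of \<open>\<theta>\<^sub>n\<close>, so a starting point always exists and is given by an explicit sum
  (\<open>follows_eventually_cyclic\<close>). It is unique, because the distance of two such orbits tends to \<open>0\<close>
  while the increments of the distance vector over full periods lie in the lattice
  (\<open>follows_start_unique\<close>). The two constructions therefore invert each other.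

  The analytic ingredient is that \<open>\<Sum>\<^sub>n \<parallel>M\<^sup>n x\<parallel>\<close> converges for every \<open>x\<close>
  (\<open>expansive_summable_inverse_powers\<close>). It is obtained by factoring a polynomial that annihilates \<open>x\<close>.
\<close>

section \<open>Powers of a contracting complex matrix\<close>

text \<open>
  This is \<open>p(F)v\<close>. Matrices carry the componentwise product here, so \<open>poly\<close> cannot be
  used directly for the evaluation at \<open>F\<close>.
\<close>

definition poly_act :: "complex^'n^'n \<Rightarrow> complex poly \<Rightarrow> complex^'n \<Rightarrow> complex^'n" where
  "poly_act F p v = (\<Sum>i\<le>degree p. coeff p i *s ((*v) F ^^ i) v)"

lemma poly_act_upto:
  assumes "degree p \<le> N"
  shows "poly_act F p v = (\<Sum>i\<le>N. coeff p i *s ((*v) F ^^ i) v)"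
  unfolding poly_act_def using assms
  by (intro sum.mono_neutral_left) (auto simp: coeff_eq_0)

lemma funpow_matrix_add:
  fixes F :: "'a::comm_ring_1^'n^'n"
  shows "((*v) F ^^ n) (x + y) = ((*v) F ^^ n) x + ((*v) F ^^ n) y"
  by (induction n) (simp_all add: matrix_vector_right_distrib)

lemma funpow_matrix_scale:
  fixes F :: "'a::field^'n^'n"
  shows "((*v) F ^^ n) (c *s x) = c *s ((*v) F ^^ n) x"
  by (induction n) (simp_all add: vec.scale)

lemma funpow_matrix_diff:
  fixes F :: "'a::comm_ring_1^'n^'n"
  shows "((*v) F ^^ n) (x - y) = ((*v) F ^^ n) x - ((*v) F ^^ n) y"
  by (induction n) (simp_all add: matrix_vector_mult_diff_distrib)

lemma poly_act_diff_arg: "poly_act F p (x - y) = poly_act F p x - poly_act F p y"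
  by (simp add: poly_act_def funpow_matrix_diff vec.scale_right_diff_distrib sum_subtractf)

lemma poly_act_scale_arg: "poly_act F p (c *s x) = c *s poly_act F p x"
  by (simp add: poly_act_def funpow_matrix_scale vec.scale_sum_right mult.commute)

lemma matrix_poly_act: "F *v poly_act F p x = poly_act F p (F *v x)"
  by (simp add: poly_act_def vec.sum vec.scale flip: funpow_swap1)

lemma poly_act_linear_factor:
  "poly_act F ([:- c, 1:] * q) v = F *v poly_act F q v - c *s poly_act F q v"
proof -
  let ?N = "Suc (degree q)"
  have "degree ([:- c, 1:] * q) \<le> ?N"
    using degree_mult_le[of "[:-c,1:]" q] by (simp split: if_splits)
  then have "poly_act F ([:- c, 1:] * q) v
      = (\<Sum>i\<le>?N. coeff (pCons 0 q) i *s ((*v) F ^^ i) v) - (\<Sum>i\<le>?N. c *s (coeff q i *s ((*v) F ^^ i) v))"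
    by (subst poly_act_upto[of _ ?N])
      (simp_all add: vec.scale_left_diff_distrib sum_subtractf algebra_simps)
  also have "(\<Sum>i\<le>?N. coeff (pCons 0 q) i *s ((*v) F ^^ i) v) = F *v poly_act F q v"
    by (simp only: sum.atMost_Suc_shift) (simp add: poly_act_def vec.sum vec.scale)
  also have "(\<Sum>i\<le>?N. c *s (coeff q i *s ((*v) F ^^ i) v)) = c *s poly_act F q v"
    by (simp add: poly_act_upto[of q ?N] vec.scale_sum_right vec.scale_right_distrib)
  finally show ?thesis .
qed

text \<open>
  The \<open>d + 1\<close> vectors \<open>v, Fv, \<dots>, F\<^sup>dv\<close> of a \<open>d\<close>-dimensional space are linearly dependent. If two of
  them coincide, a difference of two monomials does the job.
\<close>

lemma annihilating_poly_exists:
  fixes F :: "complex^'n^'n"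
  shows "\<exists>p. p \<noteq> 0 \<and> poly_act F p v = 0"
proof (cases "inj_on (\<lambda>i. ((*v) F ^^ i) v) {..CARD('n)}")
  case False
  then obtain i j where ij: "i \<noteq> j" "((*v) F ^^ i) v = ((*v) F ^^ j) v"
    by (auto simp: inj_on_def)
  define p where "p = monom (1::complex) i - monom 1 j"
  have "coeff p i \<noteq> 0" using ij by (simp add: p_def)
  then have "p \<noteq> 0" by auto
  have "degree p \<le> i + j"
    unfolding p_def by (intro degree_diff_le) (auto simp: degree_monom_eq)
  then have "poly_act F p v = (\<Sum>l\<le>i + j. (if l = i then ((*v) F ^^ l) v else 0) - (if l = j then ((*v) F ^^ l) v else 0))"
    by (subst poly_act_upto[of _ "i + j"]) (auto simp: p_def intro!: sum.cong)
  also have "\<dots> = 0" using ij by (simp add: sum_subtractf)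
  finally show ?thesis using \<open>p \<noteq> 0\<close> by blast
next
  case True
  let ?g = "\<lambda>i. ((*v) F ^^ i) v" and ?N = "CARD('n)"
  let ?S = "?g ` {..?N}"
  have "vec.dependent ?S"
  proof (rule vec.dependent_biggerset_general)
    have "vec.dim ?S \<le> ?N" using vec.dim_subset_UNIV[of ?S] by (simp add: vec.dimension_def card_cart_basis)
    also have "?N < card ?S" using True by (simp add: card_image)
    finally show "vec.dim ?S < card ?S" .
  qed
  then obtain u w where w: "w \<in> ?S" "u w \<noteq> 0" and u: "(\<Sum>w\<in>?S. u w *s w) = 0"
    by (subst (asm) vec.dependent_finite) auto
  define p where "p = (\<Sum>i\<le>?N. monom (u (?g i)) i)"
  have c: "coeff p i = (if i \<le> ?N then u (?g i) else 0)" for i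
    by (simp add: p_def coeff_sum)
  have "degree p \<le> ?N" by (rule degree_le) (simp add: c)
  then have "poly_act F p v = (\<Sum>w\<in>?S. u w *s w)"
    using True by (simp add: poly_act_upto[of p ?N] c sum.reindex)
  moreover have "p \<noteq> 0" using w c by (metis (no_types, lifting) atMost_iff coeff_0 imageE)
  ultimately show ?thesis using u by auto
qed

lemma norm_vector_scale: "norm (c *s v) = cmod c * norm (v :: complex^'n)"
  by (simp add: norm_vec_def norm_mult L2_set_right_distrib)

text \<open>
  Sum the inequality: a partial sum \<open>s\<close> satisfies \<open>s \<le> \<parallel>a\<^sub>0\<parallel> + r s + \<Sum>\<^sub>i \<parallel>w\<^sub>i\<parallel>\<close>, which bounds it since
  \<open>r < 1\<close>.
\<close>

lemma summable_perturbed_geometric: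
  fixes a w :: "nat \<Rightarrow> 'a::real_normed_vector"
  assumes "summable (\<lambda>n. norm (w n))" and "r < 1"
    and step: "\<And>n. norm (a (Suc n)) \<le> r * norm (a n) + norm (w n)"
  shows "summable (\<lambda>n. norm (a n))"
proof (rule summableI_nonneg_bounded)
  let ?W = "\<Sum>n. norm (w n)"
  fix n
  let ?s = "\<Sum>i<n. norm (a i)"
  have "?s \<le> (\<Sum>i<Suc n. norm (a i))" by simp
  also have "\<dots> = norm (a 0) + (\<Sum>i<n. norm (a (Suc i)))" by (rule sum.lessThan_Suc_shift)
  also have "(\<Sum>i<n. norm (a (Suc i))) \<le> (\<Sum>i<n. r * norm (a i) + norm (w i))"
    by (intro sum_mono step)
  also have "\<dots> = r * ?s + (\<Sum>i<n. norm (w i))" by (simp add: sum.distrib sum_distrib_left)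
  also have "(\<Sum>i<n. norm (w i)) \<le> ?W" by (rule sum_le_suminf[OF assms(1)]) auto
  finally have "(1 - r) * ?s \<le> norm (a 0) + ?W" by (simp add: algebra_simps)
  then show "?s \<le> (norm (a 0) + ?W) / (1 - r)"
    using \<open>r < 1\<close> by (simp add: field_simps)
qed simp

text \<open>
  Take \<open>p \<noteq> 0\<close> with \<open>p(F)v = 0\<close> and split off its linear factors one after the other. For a factor
  \<open>F - c\<close> with \<open>\<bar>c\<bar> < 1\<close>, the powers of \<open>F\<close> on \<open>v\<close> form a geometric sequence of ratio \<open>c\<close> perturbed
  by the powers on \<open>w = (F - c)v\<close>, and \<open>w\<close> is annihilated by the cofactor. If \<open>\<bar>c\<bar> \<ge> 1\<close>, then \<open>c\<close> is
  not an eigenvalue and the factor can be cancelled.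
\<close>

theorem summable_matrix_powers_complex:
  fixes F :: "complex^'n^'n"
  assumes eig: "\<And>\<mu> v. v \<noteq> 0 \<Longrightarrow> F *v v = \<mu> *s v \<Longrightarrow> cmod \<mu> < 1"
  shows "summable (\<lambda>n. norm (((*v) F ^^ n) v))"
proof -
  have "summable (\<lambda>n. norm (((*v) F ^^ n) v))" if "p \<noteq> 0" "poly_act F p v = 0" for p v
    using that
  proof (induction "degree p" arbitrary: p v)
    case 0
    then obtain a where "p = [:a:]" "a \<noteq> 0" by (metis degree_eq_zeroE pCons_0_0)
    with 0 have "v = 0" by (simp add: poly_act_def)
    moreover have "((*v) F ^^ n) 0 = 0" for n by (induction n) simp_all
    ultimately show ?case by simp
  next
    case (Suc d)
    then have "\<not> constant (poly p)" by (simp add: constant_degree)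
    then obtain c where "poly p c = 0" using fundamental_theorem_of_algebra by blast
    then obtain q where q: "p = [:- c, 1:] * q" by (auto simp: poly_eq_0_iff_dvd)
    with Suc have "q \<noteq> 0" by auto
    with Suc(2) q have d: "d = degree q" by (simp add: degree_mult_eq del: mult_pCons_left)
    have 0: "F *v poly_act F q v - c *s poly_act F q v = 0"
      using Suc.prems q by (simp only: poly_act_linear_factor)
    show ?case
    proof (cases "cmod c < 1")
      case True
      define w where "w = F *v v - c *s v"
      have "poly_act F q w = 0"
        using 0 by (simp add: w_def poly_act_diff_arg poly_act_scale_arg matrix_poly_act)
      then have "summable (\<lambda>n. norm (((*v) F ^^ n) w))" by (rule Suc.hyps(1)[OF d \<open>q \<noteq> 0\<close>])
      then show ?thesis
      proof (rule summable_perturbed_geometric[OF _ True])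
        fix n
        have "((*v) F ^^ Suc n) v = ((*v) F ^^ n) (c *s v + w)"
          by (simp add: w_def funpow_swap1)
        also have "\<dots> = c *s ((*v) F ^^ n) v + ((*v) F ^^ n) w"
          by (simp only: funpow_matrix_add funpow_matrix_scale)
        finally show "norm (((*v) F ^^ Suc n) v) \<le> cmod c * norm (((*v) F ^^ n) v) + norm (((*v) F ^^ n) w)"
          by (metis norm_triangle_ineq norm_vector_scale)
      qed
    next
      case False
      then have "poly_act F q v = 0" using eig[of "poly_act F q v" c] 0 by auto
      then show ?thesis by (rule Suc.hyps(1)[OF d \<open>q \<noteq> 0\<close>])
    qed
  qed
  then show ?thesis using annihilating_poly_exists by blast
qed


section \<open>Expansive integer matrices\<close>

lemma det_eq_0_iff_kernel:
  fixes A :: "'a::field^'n^'n"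
  shows "det A = 0 \<longleftrightarrow> (\<exists>v. v \<noteq> 0 \<and> A *v v = 0)"
proof -
  have "det A \<noteq> 0 \<longleftrightarrow> inj ((*v) A)"
    by (metis invertible_det_nz invertible_left_inverse matrix_left_invertible_injective)
  also have "\<dots> \<longleftrightarrow> (\<forall>v. A *v v = 0 \<longrightarrow> v = 0)"
    by (rule vec.inj_iff_eq_0)
  finally show ?thesis by blast
qed

lemma mat_vector_mult: "mat c *v v = c *s v"
  by (simp add: matrix_vector_mult_def mat_def vec_eq_iff if_distrib[of "\<lambda>a. a * _"] cong: if_cong)

lemma eigenvalue_iff_det:
  fixes A :: "'a::field^'n^'n"
  shows "(\<exists>v. v \<noteq> 0 \<and> A *v v = \<mu> *s v) \<longleftrightarrow> det (A - mat \<mu>) = 0"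
  by (simp add: det_eq_0_iff_kernel matrix_vector_mult_diff_rdistrib mat_vector_mult)

lemma det_map_matrix_of_int: "det (map_matrix of_int A :: 'a::comm_ring_1^'n^'n) = of_int (det A)"
  by (simp add: det_def)

text \<open>
  Expansiveness speaks of \<open>A\<close>, whereas the iterated function system is built from the transpose;
  both matrices have the same characteristic determinant.
\<close>

lemma eigenvalue_transpose:
  fixes A :: "'a::field^'n^'n"
  shows "(\<exists>v. v \<noteq> 0 \<and> transpose A *v v = \<mu> *s v) \<longleftrightarrow> (\<exists>v. v \<noteq> 0 \<and> A *v v = \<mu> *s v)"
proof -
  have "transpose A - mat \<mu> = transpose (A - mat \<mu>)"
    by (auto simp: transpose_def mat_def vec_eq_iff)
  then show ?thesis by (simp only: eigenvalue_iff_det det_transpose)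
qed

lemma expansive_transpose:
  fixes A :: "int^'n^'n"
  assumes "expansive A"
  shows "expansive (transpose A)"
proof -
  have "map_matrix of_int (transpose A) = transpose (map_matrix of_int A :: complex^'n^'n)"
    by (simp add: transpose_def vec_eq_iff)
  then show ?thesis
    using assms eigenvalue_transpose unfolding expansive_def by metis
qed

lemma expansive_det_nonzero:
  fixes A :: "int^'n^'n"
  assumes "expansive A"
  shows "det A \<noteq> 0"
proof
  assume "det A = 0"
  then have "det (map_matrix of_int A :: complex^'n^'n) = 0" by (simp add: det_map_matrix_of_int)
  then obtain v :: "complex^'n" where v: "v \<noteq> 0" "map_matrix of_int A *v v = 0 *s v"
    by (auto simp: det_eq_0_iff_kernel)
  then show False using assms unfolding expansive_def by (metis norm_zero not_one_less_zero)
qed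

lemma matrix_inv_inverse:
  fixes B :: "'a::field^'n^'n"
  assumes "det B \<noteq> 0"
  shows "B *v (matrix_inv B *v x) = x" "matrix_inv B *v (B *v x) = x"
proof -
  have "\<exists>C. B ** C = mat 1 \<and> C ** B = mat 1"
    using assms by (simp flip: invertible_det_nz add: invertible_def)
  then have "B ** matrix_inv B = mat 1 \<and> matrix_inv B ** B = mat 1"
    unfolding matrix_inv_def by (rule someI_ex)
  then show "B *v (matrix_inv B *v x) = x" "matrix_inv B *v (B *v x) = x"
    by (simp_all add: matrix_vector_mul_assoc)
qed

lemma det_AT_nonzero: "expansive A \<Longrightarrow> det (AT A) \<noteq> 0"
  by (simp add: AT_def det_map_matrix_of_int expansive_det_nonzero)

text \<open>
  An eigenvalue of the inverse is \<open>0\<close> or the reciprocal of an eigenvalue of the transpose, hence of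
  modulus less than \<open>1\<close>. The result for complex matrices then applies to the complexification.
\<close>

theorem expansive_summable_inverse_powers:
  fixes A :: "int^'n^'n" and x :: "real^'n"
  assumes "expansive A"
  shows "summable (\<lambda>n. norm (AT_inv_pow A n x))"
proof -
  define B where "B = (map_matrix of_int (transpose A) :: complex^'n^'n)"
  define c where "c = (\<lambda>x::real^'n. \<chi> i. complex_of_real (x $ i))"
  have "expansive (transpose A)" by (rule expansive_transpose[OF assms])
  then have B: "cmod \<mu> > 1" if "v \<noteq> 0" "B *v v = \<mu> *s v" for \<mu> v
    using that unfolding expansive_def B_def by blast
  have det: "det B \<noteq> 0"
    using expansive_det_nonzero[OF assms] by (simp add: B_def det_map_matrix_of_int)
  have Bc: "B *v c y = c (AT A *v y)" for y
    by (simp add: B_def c_def AT_def matrix_vector_mult_def vec_eq_iff)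
  have "matrix_inv B *v c y = c (matrix_inv (AT A) *v y)" for y
    by (metis Bc assms det det_AT_nonzero matrix_inv_inverse)
  then have "((*v) (matrix_inv B) ^^ n) (c x) = c (AT_inv_pow A n x)" for n
    by (induction n) simp_all
  moreover have "norm (c y) = norm y" for y by (simp add: c_def norm_vec_def)
  moreover have "summable (\<lambda>n. norm (((*v) (matrix_inv B) ^^ n) (c x)))"
  proof (rule summable_matrix_powers_complex)
    fix \<mu> v assume v: "v \<noteq> 0" "matrix_inv B *v v = \<mu> *s v"
    show "cmod \<mu> < 1"
    proof (cases "\<mu> = 0")
      case False
      have "v = \<mu> *s (B *v v)" using v(2) det by (metis matrix_inv_inverse(1) vec.scale)
      then have "B *v v = inverse \<mu> *s v" using False
        by (metis left_inverse vec.scale_scale vec.scale_one)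
      then have "cmod (inverse \<mu>) > 1" by (rule B[OF v(1)])
      then show ?thesis using False by (simp add: norm_inverse one_less_inverse_iff)
    qed simp
  qed
  ultimately show ?thesis by simp
qed
section \<open>The integer lattice and digit sets\<close>

lemma lattice_0: "0 \<in> lattice"
  and lattice_add: "x \<in> lattice \<Longrightarrow> y \<in> lattice \<Longrightarrow> x + y \<in> lattice"
  and lattice_diff: "x \<in> lattice \<Longrightarrow> y \<in> lattice \<Longrightarrow> x - y \<in> lattice"
  and lattice_minus: "x \<in> lattice \<Longrightarrow> - x \<in> lattice"
  by (simp_all add: lattice_def)

lemma lattice_norm_less_1:
  assumes "x \<in> lattice" "norm x < 1"
  shows "x = 0"
  unfolding vec_eq_iff
proof
  fix i
  have "\<bar>x $ i\<bar> < 1" using component_le_norm_cart[of x i] assms(2) by linarith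
  then show "x $ i = 0 $ i" using assms(1) Ints_nonzero_abs_less1[of "x $ i"] unfolding lattice_def by auto
qed

lemma finite_lattice_box: "finite {k \<in> lattice :: (real^'n) set. \<forall>i. \<bar>k $ i\<bar> \<le> r}"
proof (rule finite_subset)
  show "{k \<in> lattice :: (real^'n) set. \<forall>i. \<bar>k $ i\<bar> \<le> r}
          \<subseteq> vec_lambda ` PiE UNIV (\<lambda>_. {a \<in> \<int>. \<bar>a\<bar> \<le> r})"
  proof
    fix k :: "real^'n" assume "k \<in> {k \<in> lattice. \<forall>i. \<bar>k $ i\<bar> \<le> r}"
    then have "vec_nth k \<in> PiE UNIV (\<lambda>_. {a \<in> \<int>. \<bar>a\<bar> \<le> r})" by (auto simp: lattice_def)
    then show "k \<in> vec_lambda ` PiE UNIV (\<lambda>_. {a \<in> \<int>. \<bar>a\<bar> \<le> r})"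
      by (rule image_eqI[rotated]) simp
  qed
  show "finite (vec_lambda ` PiE UNIV (\<lambda>_::'n. {a \<in> \<int>. \<bar>a\<bar> \<le> r}) :: (real^'n) set)"
    by (intro finite_imageI finite_PiE finite_abs_int_segment) simp
qed

lemma finite_minus_lattice_ball:
  fixes C :: "(real^'n) set"
  assumes "finite C"
  shows "finite {x \<in> minus_lattice C. norm x \<le> r}"
proof (rule finite_subset)
  show "{x \<in> minus_lattice C. norm x \<le> r}
          \<subseteq> (\<Union>c\<in>C. (\<lambda>k. c - k) ` {k \<in> lattice. \<forall>i. \<bar>k $ i\<bar> \<le> r + norm c})"
  proof
    fix x assume "x \<in> {x \<in> minus_lattice C. norm x \<le> r}"
    then obtain c k where x: "x = c - k" "c \<in> C" "k \<in> lattice" "norm x \<le> r"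
      by (auto simp: minus_lattice_def)
    have "norm k \<le> r + norm c"
      using norm_triangle_ineq4[of c x] x by simp
    then have "\<forall>i. \<bar>k $ i\<bar> \<le> r + norm c"
      using component_le_norm_cart order_trans by blast
    with x show "x \<in> (\<Union>c\<in>C. (\<lambda>k. c - k) ` {k \<in> lattice. \<forall>i. \<bar>k $ i\<bar> \<le> r + norm c})" by blast
  qed
  show "finite (\<Union>c\<in>C. (\<lambda>k. c - k) ` {k \<in> lattice. \<forall>i. \<bar>k $ i\<bar> \<le> r + norm c})"
    using assms by (intro finite_UN_I finite_imageI finite_lattice_box)
qed

lemma det_in_Ints:
  assumes "\<And>i j. B $ i $ j \<in> (\<int> :: 'a::comm_ring_1 set)"
  shows "det B \<in> \<int>"
  using assms by (auto simp: det_def intro!: Ints_sum Ints_mult Ints_prod)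

text \<open>
  By Cramer's rule the solution of \<open>A\<^sup>T y = k\<close> has the integer determinants \<open>x $ l\<close> as numerators over
  \<open>det A\<^sup>T\<close>; so \<open>\<int>\<^sup>d / A\<^sup>T\<int>\<^sup>d\<close> is annihilated by the determinant.
\<close>

lemma det_scaled_lattice_in_image:
  fixes A :: "int^'n^'n"
  assumes det: "det (AT A) \<noteq> 0" and k: "k \<in> lattice"
  shows "det (AT A) *s k \<in> (*v) (AT A) ` lattice"
proof -
  let ?B = "AT A" and ?b = "det (AT A) *s k"
  define x where "x = (\<chi> l. det (\<chi> i j. if j = l then k $ i else AT A $ i $ j))"
  have "?B *v ((1 / det ?B) *s x) = k"
    unfolding cramer[OF det] by (simp add: x_def vec_eq_iff)
  then have "det ?B *s (?B *v ((1 / det ?B) *s x)) = ?b" by simp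
  then have "?B *v x = ?b" using det by (simp flip: vec.scale)
  moreover have "x \<in> lattice"
    using k by (auto simp: x_def lattice_def AT_def intro!: det_in_Ints)
  ultimately show ?thesis by (metis imageI)
qed

text \<open>
  Reducing the coordinates modulo the determinant does not change the class of a digit and moves
  it into a bounded box. As digits in the same class coincide, this reduction is injective.
\<close>

lemma complete_reps_finite:
  fixes A :: "int^'n^'n"
  assumes det: "det (AT A) \<noteq> 0" and reps: "complete_reps A D"
  shows "finite D"
proof -
  have D: "D \<subseteq> lattice"
    and uniq: "\<forall>k\<in>lattice. \<exists>!d. d \<in> D \<and> k - d \<in> (*v) (AT A) ` lattice"
    using reps unfolding complete_reps_def by blast+
  define N where "N = \<bar>det (AT A)\<bar>"
  have "AT A $ i $ j \<in> \<int>" for i j by (simp add: AT_def)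
  then have N: "N > 0" "det (AT A) \<in> \<int>" using det by (auto simp: N_def intro: det_in_Ints)
  define g where "g = (\<lambda>d :: real^'n. d - det (AT A) *s (\<chi> i. of_int \<lfloor>d $ i / det (AT A)\<rfloor>))"
  have gD: "d - g d \<in> (*v) (AT A) ` lattice" for d
    unfolding g_def using det_scaled_lattice_in_image[OF det] by (simp add: lattice_def)
  have "inj_on g D"
  proof (rule inj_onI)
    fix d e assume de: "d \<in> D" "e \<in> D" "g d = g e"
    obtain a b where ab: "d - g d = AT A *v a" "e - g e = AT A *v b" "a \<in> lattice" "b \<in> lattice"
      using gD by (metis imageE)
    have "d - e = (d - g d) - (e - g e)" using de by simp
    then have "d - e = AT A *v (a - b)" by (simp only: ab matrix_vector_mult_diff_distrib)
    then have "d - e \<in> (*v) (AT A) ` lattice" using ab lattice_diff by blast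
    moreover have "d - d \<in> (*v) (AT A) ` lattice" using lattice_0 by (auto intro!: image_eqI[of _ _ 0])
    moreover have "\<exists>!c. c \<in> D \<and> d - c \<in> (*v) (AT A) ` lattice"
      using uniq D de by blast
    ultimately show "d = e" using de by blast
  qed
  moreover have "g ` D \<subseteq> {k \<in> lattice. \<forall>i. \<bar>k $ i\<bar> \<le> N}"
  proof clarify
    fix d assume "d \<in> D"
    then have "d \<in> lattice" using D by blast
    then have "g d \<in> lattice" using N by (simp add: g_def lattice_def)
    moreover have "\<bar>g d $ i\<bar> \<le> N" for i
    proof -
      have "g d $ i = det (AT A) * frac (d $ i / det (AT A))"
        using det by (simp add: g_def frac_def right_diff_distrib)
      then have "\<bar>g d $ i\<bar> = N * frac (d $ i / det (AT A))"
        by (simp add: N_def abs_mult)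
      also have "\<dots> \<le> N * 1" using N frac_lt_1[of "d $ i / det (AT A)"] by (intro mult_left_mono) auto
      finally show ?thesis by simp
    qed
    ultimately show "g d \<in> lattice \<and> (\<forall>i. \<bar>g d $ i\<bar> \<le> N)" by simp
  qed
  ultimately show ?thesis using finite_lattice_box inj_on_finite by blast
qed

section \<open>Shifts of the solenoid\<close>

lemma torus_exp_add: "torus_exp x * torus_exp y = torus_exp (x + y)"
  by (simp add: torus_exp_def vec_eq_iff distrib_left flip: exp_add)

text \<open>
  The inverse of \<open>\<sigma>\<^sub>A\<close> drops the first coordinate, which the others determine. This makes
  \<open>\<sigma>\<^bsup>-j\<^esup>(\<chi>\<^sub>C)\<close> explicit.
\<close>

lemma sigma_inv_shift:
  assumes "z \<in> solenoid A"
  shows "sigma_inv A z = (\<lambda>n. z (Suc n))"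
proof -
  have "(\<lambda>n. z (Suc n)) \<in> solenoid A" using assms by (simp add: solenoid_def)
  moreover have "sigma A (\<lambda>n. z (Suc n)) = z"
    using assms by (auto simp: sigma_def solenoid_def fun_eq_iff split: nat.split)
  ultimately show ?thesis
    unfolding sigma_inv_def using sigma_bij[of A] by (metis bij_betw_imp_inj_on inv_into_f_f)
qed

lemma sigma_inv_funpow:
  assumes "z \<in> solenoid A"
  shows "(sigma_inv A ^^ j) z = (\<lambda>n. z (n + j))"
proof -
  have "(\<lambda>n. z (n + j)) \<in> solenoid A" for j using assms by (simp add: solenoid_def)
  then show ?thesis by (induction j) (simp_all add: sigma_inv_shift)
qed
section \<open>Orbits along words\<close>

text \<open>
  The lift of \<^const>\<open>word_path\<close> from the torus to \<open>\<real>\<^sup>d\<close>.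
\<close>

definition word_orbit :: "int^'d^'d \<Rightarrow> (nat \<Rightarrow> real^'d) \<Rightarrow> real^'d \<Rightarrow> nat \<Rightarrow> real^'d" where
  "word_orbit A \<omega> x n = fold (tau A) (map \<omega> [0..<n]) x"

lemma word_orbit_0 [simp]: "word_orbit A \<omega> x 0 = x"
  and word_orbit_Suc [simp]: "word_orbit A \<omega> x (Suc n) = tau A (\<omega> n) (word_orbit A \<omega> x n)"
  by (simp_all add: word_orbit_def)

lemma word_path_word_orbit: "word_path A \<omega> x n = torus_exp (word_orbit A \<omega> x n)"
  by (simp add: word_path_def word_orbit_def)

lemma fold_tau_word_orbit: "fold (tau A) m x = word_orbit A ((!) m) x (length m)"
  by (simp add: word_orbit_def map_nth)

text \<open>
  All \<open>\<tau>\<^sub>d\<close> share the linear part \<open>(A\<^sup>T)\<^sup>-\<^sup>1\<close>. This removes the variable \<open>x\<close> from the comparison of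
  an orbit with a line in the solenoid.
\<close>

lemma word_orbit_diff:
  "word_orbit A \<omega> x n - word_orbit A \<omega> y n = AT_inv_pow A n (x - y)"
  by (induction n)
    (simp_all add: tau_def flip: matrix_vector_mult_diff_distrib)

text \<open>
  The digits are indexed backwards, so that the sum is dominated by a series that does not depend
  on \<open>n\<close>.
\<close>

lemma word_orbit_explicit:
  "word_orbit A \<omega> x n = AT_inv_pow A n x + (\<Sum>i<n. AT_inv_pow A (Suc i) (\<omega> (n - Suc i)))"
proof (induction n)
  case (Suc n)
  have "(\<Sum>i<Suc n. AT_inv_pow A (Suc i) (\<omega> (Suc n - Suc i)))
      = matrix_inv (AT A) *v \<omega> n + (\<Sum>i<n. matrix_inv (AT A) *v AT_inv_pow A (Suc i) (\<omega> (n - Suc i)))"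
    by (subst sum.lessThan_Suc_shift) simp
  also have "\<dots> = matrix_inv (AT A) *v (\<omega> n + (\<Sum>i<n. AT_inv_pow A (Suc i) (\<omega> (n - Suc i))))"
    by (simp only: matrix_vector_right_distrib vec.sum)
  finally show ?case
    by (simp only: word_orbit_Suc Suc.IH tau_def) (simp add: algebra_simps)
qed simp

lemma tau_eq_iff:
  assumes "det (AT A) \<noteq> 0"
  shows "tau A d x = y \<longleftrightarrow> AT A *v y = x + d"
  unfolding tau_def by (metis matrix_inv_inverse[OF assms])

text \<open>
  The same orbit read backwards, with integer coefficients: the source of the formula for \<open>k(\<omega>)\<close>.
\<close>

lemma AT_pow_word_orbit:
  assumes "det (AT A) \<noteq> 0"
  shows "AT_pow A n (word_orbit A \<omega> x n) = x + (\<Sum>i<n. AT_pow A i (\<omega> i))"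
proof (induction n)
  case (Suc n)
  have "AT A *v word_orbit A \<omega> x (Suc n) = word_orbit A \<omega> x n + \<omega> n"
    using tau_eq_iff[OF assms] by (metis word_orbit_Suc)
  then have "AT_pow A (Suc n) (word_orbit A \<omega> x (Suc n)) = AT_pow A n (word_orbit A \<omega> x n + \<omega> n)"
    by (simp only: funpow_Suc_right o_apply)
  then show ?case by (simp add: funpow_matrix_add Suc.IH)
qed simp

lemma AT_pow_inj:
  assumes "det (AT A) \<noteq> 0" "AT_pow A n x = AT_pow A n y"
  shows "x = y"
proof -
  have "AT_inv_pow A n (AT_pow A n z) = z" for z
    by (induction n arbitrary: z) (simp_all add: funpow_swap1 matrix_inv_inverse[OF assms(1)])
  then show ?thesis by (metis assms(2))
qed

lemma AT_inv_pow_inj: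
  assumes "det (AT A) \<noteq> 0" "AT_inv_pow A n x = AT_inv_pow A n y"
  shows "x = y"
proof -
  have "AT_pow A n (AT_inv_pow A n z) = z" for z
    by (induction n arbitrary: z) (simp_all add: funpow_swap1 matrix_inv_inverse[OF assms(1)])
  then show ?thesis by (metis assms(2))
qed

lemma AT_inv_pow_tendsto_0:
  assumes "expansive A"
  shows "(\<lambda>n. AT_inv_pow A n x) \<longlonglongrightarrow> 0"
  by (rule tendsto_norm_zero_cancel, rule summable_LIMSEQ_zero,
      rule expansive_summable_inverse_powers[OF assms])

text \<open>
  A fixed point of a power would be a constant subsequence of a sequence tending to \<open>0\<close>.
\<close>

lemma AT_inv_pow_fixed_zero:
  assumes "expansive A" "q > 0" and fixed: "AT_inv_pow A q x = x"
  shows "x = 0"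
proof -
  have "AT_inv_pow A (i * q) x = x" for i
    by (induction i) (simp_all add: funpow_add fixed)
  moreover have "(\<lambda>i. AT_inv_pow A (i * q) x) \<longlonglongrightarrow> 0"
    using LIMSEQ_subseq_LIMSEQ[OF AT_inv_pow_tendsto_0[OF assms(1)], of "\<lambda>i. i * q" x] \<open>q > 0\<close>
    by (simp add: strict_mono_def o_def)
  ultimately show ?thesis by (simp add: LIMSEQ_const_iff)
qed

lemma word_orbit_bounded:
  assumes "expansive A" "finite D" "\<omega> \<in> infinite_words D"
  shows "\<exists>r. \<forall>n. norm (word_orbit A \<omega> x n) \<le> r"
proof -
  define g where "g = (\<lambda>i. \<Sum>d\<in>D. norm (AT_inv_pow A i d))"
  have g: "summable g"
    unfolding g_def by (rule summable_sum, rule expansive_summable_inverse_powers[OF assms(1)])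
  then have gS: "summable (\<lambda>i. g (Suc i))" using summable_Suc_iff[of g] by blast
  have sx: "summable (\<lambda>n. norm (AT_inv_pow A n x))"
    by (rule expansive_summable_inverse_powers[OF assms(1)])
  have "norm (word_orbit A \<omega> x n) \<le> (\<Sum>i. norm (AT_inv_pow A i x)) + (\<Sum>i. g (Suc i))" for n
  proof -
    have "norm (AT_inv_pow A n x) \<le> (\<Sum>i<Suc n. norm (AT_inv_pow A i x))"
      by (simp add: sum_nonneg)
    also have "\<dots> \<le> (\<Sum>i. norm (AT_inv_pow A i x))" by (rule sum_le_suminf[OF sx]) auto
    finally have 1: "norm (AT_inv_pow A n x) \<le> (\<Sum>i. norm (AT_inv_pow A i x))" .
    have "norm (\<Sum>i<n. AT_inv_pow A (Suc i) (\<omega> (n - Suc i))) \<le> (\<Sum>i<n. g (Suc i))"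
      unfolding g_def using assms(2,3)
      by (intro sum_norm_le member_le_sum[where f = "\<lambda>d. norm (AT_inv_pow A (Suc i) d)" for i])
        (auto simp: infinite_words_def)
    also have "\<dots> \<le> (\<Sum>i. g (Suc i))"
      by (rule sum_le_suminf[OF gS]) (auto simp: g_def intro!: sum_nonneg)
    finally have 2: "norm (\<Sum>i<n. AT_inv_pow A (Suc i) (\<omega> (n - Suc i))) \<le> (\<Sum>i. g (Suc i))" .
    show ?thesis unfolding word_orbit_explicit by (rule norm_triangle_mono[OF 1 2])
  qed
  then show ?thesis by blast
qed

section \<open>Cycles and the attractor\<close>

lemma word_orbit_cycle:
  assumes "cycle_list A D \<eta> m"
  shows "word_orbit A (\<lambda>i. m ! (i mod length m)) (\<eta> ! 0) n = \<eta> ! (n mod length \<eta>)"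
proof (induction n)
  case (Suc n)
  have "n mod length \<eta> < length \<eta>" using assms by (auto simp: cycle_list_def)
  then have "tau A (m ! (n mod length m)) (\<eta> ! (n mod length \<eta>)) = \<eta> ! (Suc (n mod length \<eta>) mod length \<eta>)"
    using assms by (auto simp: cycle_list_def)
  then show ?case by (simp only: word_orbit_Suc Suc.IH mod_Suc_eq)
qed simp

lemma fold_tau_cycle:
  assumes "cycle_list A D \<eta> m"
  shows "fold (tau A) m (\<eta> ! 0) = \<eta> ! 0"
proof -
  have "map ((!) m) [0..<length m] = map (\<lambda>i. m ! (i mod length m)) [0..<length m]"
    by simp
  then have "fold (tau A) m (\<eta> ! 0) = word_orbit A (\<lambda>i. m ! (i mod length m)) (\<eta> ! 0) (length m)"
    unfolding word_orbit_def by (metis map_nth)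
  with assms show ?thesis unfolding word_orbit_cycle[OF assms] by (simp add: cycle_list_def)
qed

lemma fold_tau_fixed_point_unique:
  assumes "expansive A" "m \<noteq> []" "fold (tau A) m x = x" "fold (tau A) m y = y"
  shows "x = y"
proof -
  have "AT_inv_pow A (length m) (x - y) = x - y"
    using word_orbit_diff[of A "(!) m" x "length m" y] assms(3,4) by (simp flip: fold_tau_word_orbit)
  then have "x - y = 0" by (rule AT_inv_pow_fixed_zero[OF assms(1), rotated]) (use assms(2) in simp)
  then show ?thesis by simp
qed

text \<open>
  Unrolling the backward orbit \<open>n\<close> times gives the \<open>n\<close>-th partial sum of the digit expansion of \<open>u\<^sub>0\<close>
  plus \<open>(A\<^sup>T)\<^bsup>-n\<^esup> u\<^sub>n\<close>. The remainder vanishes in the limit because \<open>u\<close> takes only finitely many values.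
\<close>

lemma attractor_backward_orbit:
  assumes "expansive A" "finite (range u)" "d \<in> infinite_words D"
    and step: "\<And>j. u j = tau A (d j) (u (Suc j))"
  shows "u 0 \<in> attractor A D"
proof -
  have expand: "u 0 = (\<Sum>j<n. AT_inv_pow A (Suc j) (d j)) + AT_inv_pow A n (u n)" for n
  proof (induction n)
    case (Suc n)
    have "AT_inv_pow A n (u n) = AT_inv_pow A (Suc n) (u (Suc n)) + AT_inv_pow A (Suc n) (d n)"
      by (subst step)
        (simp only: tau_def funpow_Suc_right o_apply matrix_vector_right_distrib funpow_matrix_add)
    with Suc.IH show ?case by simp
  qed simp
  have "(\<lambda>n. AT_inv_pow A n (u n)) \<longlonglongrightarrow> 0"
  proof (rule Lim_null_comparison)
    show "\<forall>\<^sub>F n in sequentially. norm (AT_inv_pow A n (u n)) \<le> (\<Sum>y\<in>range u. norm (AT_inv_pow A n y))"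
      using assms(2) by (intro always_eventually allI member_le_sum) auto
    show "(\<lambda>n. \<Sum>y\<in>range u. norm (AT_inv_pow A n y)) \<longlonglongrightarrow> 0"
      by (intro tendsto_null_sum tendsto_norm_zero AT_inv_pow_tendsto_0[OF assms(1)])
  qed
  then have "(\<lambda>n. u 0 - AT_inv_pow A n (u n)) \<longlonglongrightarrow> u 0 - 0"
    by (intro tendsto_diff tendsto_const)
  moreover have "u 0 - AT_inv_pow A n (u n) = (\<Sum>j<n. AT_inv_pow A (Suc j) (d j))" for n
    using expand[of n] by (simp add: algebra_simps)
  ultimately have "(\<lambda>j. AT_inv_pow A (Suc j) (d j)) sums u 0"
    unfolding sums_def by simp
  with assms(3) show ?thesis unfolding attractor_def by blast
qed

text \<open>
  A cycle runs backwards forever inside itself.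
\<close>

lemma cycle_subset_attractor:
  assumes "expansive A" and cyc: "cycle_list A D \<eta> m"
  shows "set \<eta> \<subseteq> attractor A D"
proof
  fix x assume "x \<in> set \<eta>"
  then obtain i where i: "i < length \<eta>" "x = \<eta> ! i" by (auto simp: in_set_conv_nth)
  define q where "q = length \<eta>"
  have q: "q > 0" "length m = q" using cyc by (auto simp: cycle_list_def q_def)
  \<comment> \<open>\<open>q - 1\<close> stands for the step \<open>-1\<close> modulo \<open>q\<close>.\<close>
  define e where "e = (\<lambda>j. (i + j * (q - 1)) mod q)"
  have e: "e j < q" for j using q by (simp add: e_def)
  have step: "Suc (e (Suc j)) mod q = e j" for j
  proof -
    have "Suc (e (Suc j)) mod q = (i + Suc j * (q - 1) + 1) mod q" by (simp add: e_def mod_Suc_eq)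
    also have "i + Suc j * (q - 1) + 1 = i + j * (q - 1) + q" using q by simp
    finally show ?thesis by (simp add: e_def)
  qed
  have "\<eta> ! e 0 \<in> attractor A D"
  proof (rule attractor_backward_orbit[where d = "\<lambda>j. m ! e (Suc j)" and u = "\<lambda>j. \<eta> ! e j"])
    show "finite (range (\<lambda>j. \<eta> ! e j))"
      using e by (intro finite_subset[OF _ finite_set[of \<eta>]]) (auto simp: q_def)
    show "(\<lambda>j. m ! e (Suc j)) \<in> infinite_words D"
      using cyc e q by (auto simp: infinite_words_def cycle_list_def)
    fix j
    have "tau A (m ! e (Suc j)) (\<eta> ! e (Suc j)) = \<eta> ! (Suc (e (Suc j)) mod q)"
      using cyc e[of "Suc j"] by (simp add: cycle_list_def q_def)
    then show "\<eta> ! e j = tau A (m ! e (Suc j)) (\<eta> ! e (Suc j))" by (simp add: step)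
  qed (rule assms(1))
  then show "x \<in> attractor A D" using i by (simp add: e_def q_def)
qed
text \<open>
  The index set \<open>\<int>\<^sub>p\<close> appears below through the \<open>p\<close>-periodic extension \<open>pt\<close> of the cycle to all
  natural numbers, and \<open>x - pt n \<in> lattice\<close> expresses that \<open>x\<close> lies in \<open>\<theta>\<^sub>n - \<int>\<^sup>d = \<theta>\<^sub>n + \<int>\<^sup>d\<close>.
\<close>

locale simple_cycle_system =
  fixes A :: "int^'d^'d" and D :: "(real^'d) set" and \<theta> :: "(real^'d) list"
  assumes expansive: "expansive A"
    and reps: "complete_reps A D"
    and simple: "simple_cycle A D \<theta>"
begin

abbreviation p :: nat where "p \<equiv> length \<theta>"

definition pt :: "nat \<Rightarrow> real^'d" where "pt n = \<theta> ! (n mod p)"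

lemma det_nonzero: "det (AT A) \<noteq> 0"
  by (rule det_AT_nonzero[OF expansive])

lemma digits_lattice: "D \<subseteq> lattice"
  using reps unfolding complete_reps_def by blast

lemma finite_digits: "finite D"
  by (rule complete_reps_finite[OF det_nonzero reps])

lemma p_pos: "p > 0"
  using simple by (auto simp: simple_cycle_def cycle_list_def)

lemma pt_nth: "j < p \<Longrightarrow> pt j = \<theta> ! j"
  by (simp add: pt_def)

lemma pt_cong: "a mod p = b mod p \<Longrightarrow> pt a = pt b"
  by (simp add: pt_def)

text \<open>
  This is simplicity of the cycle: the coset of a point tells its position in the cycle.
\<close>

lemma pt_diff_lattice_iff: "pt a - pt b \<in> lattice \<longleftrightarrow> a mod p = b mod p"
proof
  assume "pt a - pt b \<in> lattice"
  then show "a mod p = b mod p"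
    using simple p_pos unfolding simple_cycle_def pt_def by (metis mod_less_divisor)
qed (simp add: pt_def lattice_0)

lemma coset_index_iff:
  assumes "x - pt a \<in> lattice"
  shows "x - pt b \<in> lattice \<longleftrightarrow> a mod p = b mod p"
proof -
  have "pt a - pt b = (x - pt b) - (x - pt a)" "x - pt b = (x - pt a) + (pt a - pt b)" by simp_all
  then have "x - pt b \<in> lattice \<longleftrightarrow> pt a - pt b \<in> lattice"
    using assms lattice_diff lattice_add by metis
  then show ?thesis by (simp only: pt_diff_lattice_iff)
qed

lemma AT_pt_Suc: "AT A *v pt (Suc n) - pt n \<in> lattice"
proof -
  obtain l where l: "cycle_list A D \<theta> l" using simple by (auto simp: simple_cycle_def)
  define i where "i = n mod p"
  have i: "i < p" using p_pos by (simp add: i_def)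
  then have "tau A (l ! i) (pt n) = pt (Suc n)"
    using l by (simp add: cycle_list_def pt_def i_def mod_Suc_eq)
  then have "AT A *v pt (Suc n) - pt n = l ! i" by (simp add: tau_eq_iff[OF det_nonzero])
  moreover have "l ! i \<in> D" using l i by (auto simp: cycle_list_def)
  ultimately show ?thesis using digits_lattice by auto
qed

lemma minus_lattice_iff: "x \<in> minus_lattice (set \<theta>) \<longleftrightarrow> (\<exists>n. x - pt n \<in> lattice)"
proof
  assume "x \<in> minus_lattice (set \<theta>)"
  then obtain n k where n: "n < p" "x = \<theta> ! n - k" "k \<in> lattice"
    by (auto simp: minus_lattice_def in_set_conv_nth)
  then have "x - pt n = - k" by (simp add: pt_nth)
  then show "\<exists>n. x - pt n \<in> lattice" using n lattice_minus by metis
next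
  assume "\<exists>n. x - pt n \<in> lattice"
  then obtain n where n: "x - pt n \<in> lattice" by blast
  have "pt n \<in> set \<theta>" using p_pos by (simp add: pt_def)
  moreover have "x = pt n - (pt n - x)" "pt n - x \<in> lattice"
    using lattice_minus[OF n] by simp_all
  ultimately show "x \<in> minus_lattice (set \<theta>)" unfolding minus_lattice_def by blast
qed

lemma minus_lattice_nth_iff:
  assumes "j < p"
  shows "x \<in> minus_lattice {\<theta> ! j} \<longleftrightarrow> x - pt j \<in> lattice"
proof
  assume "x - pt j \<in> lattice"
  then have "\<theta> ! j - x \<in> lattice" using lattice_minus assms by (fastforce simp: pt_nth)
  moreover have "x = \<theta> ! j - (\<theta> ! j - x)" by simp
  ultimately show "x \<in> minus_lattice {\<theta> ! j}" unfolding minus_lattice_def by blast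
qed (use assms lattice_minus in \<open>auto simp: minus_lattice_def pt_nth\<close>)

text \<open>
  Going backwards, no choice arises: every digit takes the coset of \<open>\<theta>\<^bsub>n+1\<^esub>\<close> back into that of \<open>\<theta>\<^sub>n\<close>.
\<close>

lemma coset_pull_back:
  assumes "d \<in> lattice"
  shows "AT A *v y = x + d \<Longrightarrow> y - pt (Suc n) \<in> lattice \<Longrightarrow> x - pt n \<in> lattice"
proof -
  assume y: "AT A *v y = x + d" "y - pt (Suc n) \<in> lattice"
  have "x - pt n = (AT A *v (y - pt (Suc n)) - d) + (AT A *v pt (Suc n) - pt n)"
    using y(1) by (simp add: matrix_vector_mult_diff_distrib)
  then show "x - pt n \<in> lattice"
    using AT_lattice[OF y(2)] AT_pt_Suc assms lattice_add lattice_diff by metis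
qed

text \<open>
  With \<open>c = A\<^sup>T \<theta>\<^bsub>n+1\<^esub> - x\<close>, which is a lattice point, the requirement on \<open>d\<close> is
  \<open>c - d \<in> A\<^sup>T\<int>\<^sup>d\<close>. So \<open>d\<close> is the representative of \<open>c\<close>.
\<close>

lemma unique_digit:
  assumes x: "x - pt n \<in> lattice"
  shows "\<exists>!d. d \<in> D \<and> tau A d x - pt (Suc n) \<in> lattice"
proof -
  define c where "c = AT A *v pt (Suc n) - x"
  have "c = (AT A *v pt (Suc n) - pt n) - (x - pt n)" by (simp add: c_def)
  then have "c \<in> lattice" using x AT_pt_Suc lattice_diff by metis
  have "tau A d x - pt (Suc n) \<in> lattice \<longleftrightarrow> c - d \<in> (*v) (AT A) ` lattice" for d
  proof -
    have *: "c - d = AT A *v (pt (Suc n) - tau A d x)"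
      using tau_eq_iff[OF det_nonzero, of d x "tau A d x"]
      by (simp add: c_def matrix_vector_mult_diff_distrib)
    have "c - d \<in> (*v) (AT A) ` lattice \<longleftrightarrow> pt (Suc n) - tau A d x \<in> lattice"
      using matrix_inv_inverse(2)[OF det_nonzero] unfolding * by (auto simp: image_iff) metis
    also have "\<dots> \<longleftrightarrow> tau A d x - pt (Suc n) \<in> lattice"
      using lattice_minus by (metis minus_diff_eq)
    finally show ?thesis by blast
  qed
  then show ?thesis using reps \<open>c \<in> lattice\<close> unfolding complete_reps_def by simp
qed

definition follows :: "(nat \<Rightarrow> real^'d) \<Rightarrow> real^'d \<Rightarrow> nat \<Rightarrow> bool" where
  "follows \<omega> x j \<longleftrightarrow> (\<forall>n. word_orbit A \<omega> x n - pt (j + n) \<in> lattice)"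

lemma chi_cycle_solenoid: "chi_cycle \<theta> \<in> solenoid A"
proof -
  have "chi_cycle \<theta> n = torus_exp (pt n)" for n by (simp add: chi_cycle_def pt_def)
  moreover have "torus_pow (torus_exp (pt (Suc n))) A = torus_exp (pt n)" for n
    by (simp add: torus_pow_torus_exp torus_exp_eq_iff AT_pt_Suc)
  ultimately show ?thesis by (simp add: solenoid_def torus_exp_in_torus)
qed

lemma i_hat_cycle_eq: "i_hat_cycle A \<theta> x j n = torus_exp (AT_inv_pow A n x + pt (j + n))"
  unfolding i_hat_cycle_def sigma_inv_funpow[OF chi_cycle_solenoid]
  by (simp add: solenoid_mult_def chi_cycle_def i_hat_def torus_exp_add pt_def add.commute)

text \<open>
  Since \<open>\<tau>\<close> along \<open>\<omega>\<close> differs at \<open>x\<close> and at \<open>\<theta>\<^sub>j - k\<close> by \<open>(A\<^sup>T)\<^bsup>-n\<^esup>(x + k - \<theta>\<^sub>j)\<close>, the arguments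
  of the exponential on the two sides of the equation at time \<open>n\<close> differ by a vector that is the same
  for every \<open>x\<close>.
\<close>

lemma word_path_eq_iff:
  assumes "j < p"
  shows "(\<forall>x. word_path A \<omega> x = i_hat_cycle A \<theta> (x + k - \<theta> ! j) j) \<longleftrightarrow> follows \<omega> (\<theta> ! j - k) j"
proof -
  have "word_path A \<omega> x n = i_hat_cycle A \<theta> (x + k - \<theta> ! j) j n
      \<longleftrightarrow> word_orbit A \<omega> (\<theta> ! j - k) n - pt (j + n) \<in> lattice" for x n
  proof -
    have "x + k - \<theta> ! j = x - (\<theta> ! j - k)" by simp
    then have "word_orbit A \<omega> x n - (AT_inv_pow A n (x + k - \<theta> ! j) + pt (j + n))
        = word_orbit A \<omega> (\<theta> ! j - k) n - pt (j + n)"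
      using word_orbit_diff[of A \<omega> x n "\<theta> ! j - k"] by (simp add: algebra_simps)
    then show ?thesis by (simp only: word_path_word_orbit i_hat_cycle_eq torus_exp_eq_iff)
  qed
  then show ?thesis by (simp add: fun_eq_iff follows_def)
qed

lemma follows_word_unique:
  assumes "\<omega> \<in> infinite_words D" "\<omega>' \<in> infinite_words D" "follows \<omega> x j" "follows \<omega>' x j"
  shows "\<omega> = \<omega>'"
proof -
  have digit: "\<omega> n = \<omega>' n" if "word_orbit A \<omega> x n = word_orbit A \<omega>' x n" for n
  proof -
    let ?y = "word_orbit A \<omega> x n"
    have "?y - pt (j + n) \<in> lattice" using assms(3) by (simp add: follows_def)
    then have "\<exists>!d. d \<in> D \<and> tau A d ?y - pt (Suc (j + n)) \<in> lattice" by (rule unique_digit)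
    moreover have "tau A (\<omega> n) ?y - pt (Suc (j + n)) \<in> lattice"
      using assms(3) unfolding follows_def by (metis add_Suc_right word_orbit_Suc)
    moreover have "tau A (\<omega>' n) ?y - pt (Suc (j + n)) \<in> lattice"
      using assms(4) that unfolding follows_def by (metis add_Suc_right word_orbit_Suc)
    moreover have "\<omega> n \<in> D" "\<omega>' n \<in> D" using assms(1,2) by (simp_all add: infinite_words_def)
    ultimately show ?thesis by blast
  qed
  have "word_orbit A \<omega> x n = word_orbit A \<omega>' x n" for n
    by (induction n) (simp_all add: digit)
  with digit show ?thesis by blast
qed

text \<open>
  Let \<open>z = x - x'\<close>. At the multiples of \<open>p\<close> both orbits are back in the cosets they started from, so
  consecutive terms of \<open>(A\<^sup>T)\<^bsup>-ip\<^esup> z\<close> differ by lattice points. The terms tend to \<open>0\<close>, and the only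
  lattice point of norm less than \<open>1\<close> is \<open>0\<close>; hence two consecutive terms agree, which makes \<open>z\<close> a
  fixed point of \<open>(A\<^sup>T)\<^bsup>-p\<^esup>\<close>.
\<close>

lemma follows_start_unique:
  assumes "follows \<omega> x j" "follows \<omega> x' j'"
  shows "x = x'"
proof -
  define u where "u = (\<lambda>i. AT_inv_pow A (i * p) (x - x'))"
  have "u (Suc i) - u i \<in> lattice" for i
  proof -
    let ?o = "\<lambda>x i. word_orbit A \<omega> x (i * p)"
    have *: "?o y i - pt l \<in> lattice" if "follows \<omega> y l" for y l i
      using that pt_cong[of "l + i * p" l] unfolding follows_def by (metis mod_mult_self1)
    have u: "u i = ?o x i - ?o x' i" for i by (simp add: u_def word_orbit_diff)
    have "u (Suc i) - u i = ((?o x (Suc i) - pt j) - (?o x' (Suc i) - pt j')) - ((?o x i - pt j) - (?o x' i - pt j'))"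
      unfolding u by simp
    also have "\<dots> \<in> lattice" by (intro lattice_diff *[OF assms(1)] *[OF assms(2)])
    finally show ?thesis .
  qed
  moreover have "u \<longlonglongrightarrow> 0"
    unfolding u_def using p_pos
      LIMSEQ_subseq_LIMSEQ[OF AT_inv_pow_tendsto_0[OF expansive], of "\<lambda>i. i * p" "x - x'"]
    by (simp add: strict_mono_def o_def)
  moreover have "\<exists>i. norm (u (Suc i) - u i) < 1"
  proof -
    have "(\<lambda>i. norm (u (Suc i) - u i)) \<longlonglongrightarrow> norm (0 - 0 :: real^'d)"
      using \<open>u \<longlonglongrightarrow> 0\<close> by (intro tendsto_norm tendsto_diff LIMSEQ_Suc)
    then have "\<forall>\<^sub>F i in sequentially. norm (u (Suc i) - u i) < 1"
      by (rule order_tendstoD) simp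
    then show ?thesis by (simp add: eventually_sequentially) blast
  qed
  ultimately obtain i where "u (Suc i) - u i = 0" using lattice_norm_less_1 by metis
  then have "AT_inv_pow A (i * p) (AT_inv_pow A p (x - x')) = AT_inv_pow A (i * p) (x - x')"
    by (simp add: u_def add.commute[of p] funpow_add)
  then have "AT_inv_pow A p (x - x') = x - x'" by (rule AT_inv_pow_inj[OF det_nonzero])
  then have "x - x' = 0" by (rule AT_inv_pow_fixed_zero[OF expansive p_pos])
  then show ?thesis by simp
qed

lemma follows_unique:
  assumes "j < p" "j' < p" "k \<in> lattice" "k' \<in> lattice"
    and "follows \<omega> (\<theta> ! j - k) j" "follows \<omega> (\<theta> ! j' - k') j'"
  shows "k = k' \<and> j = j'"
proof -
  have eq: "\<theta> ! j - k = \<theta> ! j' - k'" by (rule follows_start_unique[OF assms(5,6)])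
  then have "pt j - pt j' = k - k'" using assms(1,2) by (simp add: pt_nth algebra_simps)
  then have "pt j - pt j' \<in> lattice" using assms(3,4) lattice_diff by metis
  then have "j = j'" using assms(1,2) by (simp add: pt_diff_lattice_iff)
  with eq show ?thesis by simp
qed


section \<open>The encoding map\<close>

abbreviation R :: "real^'d \<Rightarrow> real^'d" where "R \<equiv> R_cycle A D \<theta>"

text \<open>
  Up to the sign, \<open>\<R>\<^sub>C\<close> is the unique step that follows the cycle: \<open>-x = A\<^sup>T y + d\<close> says \<open>\<tau>\<^sub>d x = -y\<close>.
\<close>

lemma R_step:
  assumes x: "x - pt n \<in> lattice"
  obtains d where "d \<in> D" "tau A d x = - R (- x)" "- R (- x) - pt (Suc n) \<in> lattice"
proof -
  obtain d where d: "d \<in> D" "tau A d x - pt (Suc n) \<in> lattice"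
    and uniq: "\<And>d'. d' \<in> D \<Longrightarrow> tau A d' x - pt (Suc n) \<in> lattice \<Longrightarrow> d' = d"
    using unique_digit[OF x] by blast
  have AT_tau: "AT A *v tau A d x = x + d" using tau_eq_iff[OF det_nonzero] by blast
  define j where "j = n mod p"
  have j: "j < p" "\<theta> ! j = pt n" "\<theta> ! (Suc j mod p) = pt (Suc n)"
    using p_pos by (simp_all add: j_def pt_def mod_Suc_eq)
  have "R (- x) = - tau A d x"
    unfolding R_cycle_def
  proof (rule the_equality)
    have "pt n - x \<in> lattice" "pt (Suc n) - tau A d x \<in> lattice"
      using lattice_minus[OF x] lattice_minus[OF d(2)] by simp_all
    moreover have "- x = pt n - x - \<theta> ! j"
      "- tau A d x = pt (Suc n) - tau A d x - \<theta> ! (Suc j mod p)"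
      by (simp_all add: j)
    moreover have "pt n - x - \<theta> ! j
        = AT A *v (pt (Suc n) - tau A d x - \<theta> ! (Suc j mod p)) + d"
      using AT_tau by (simp add: j vec.neg)
    ultimately show "\<exists>a\<in>lattice. \<exists>j<p. \<exists>b\<in>lattice. \<exists>e\<in>D. - x = a - \<theta> ! j \<and>
        - tau A d x = b - \<theta> ! (Suc j mod p) \<and> a - \<theta> ! j = AT A *v (b - \<theta> ! (Suc j mod p)) + e"
      using d(1) j(1) by blast
  next
    fix y assume "\<exists>a\<in>lattice. \<exists>j<p. \<exists>b\<in>lattice. \<exists>d\<in>D. - x = a - \<theta> ! j \<and>
        y = b - \<theta> ! (Suc j mod p) \<and> a - \<theta> ! j = AT A *v (b - \<theta> ! (Suc j mod p)) + d"
    then obtain a i b d' where i: "a \<in> lattice" "i < p" "b \<in> lattice" "d' \<in> D" "- x = a - \<theta> ! i"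
      and y: "y = b - \<theta> ! (Suc i mod p)" and "- x = AT A *v y + d'" by metis
    have "x - pt i = - a" using i by (simp add: pt_nth algebra_simps)
    then have "x - pt i \<in> lattice" using i lattice_minus by metis
    then have "pt (Suc i) = pt (Suc n)"
      using coset_index_iff[OF x] by (intro pt_cong) (metis mod_Suc_eq)
    then have y': "y = b - pt (Suc n)" using y by (simp add: pt_def)
    have "x = - (AT A *v y + d')" using \<open>- x = AT A *v y + d'\<close> by (metis minus_minus)
    then have "AT A *v (- y) = x + d'" by (simp add: vec.neg)
    then have tau: "tau A d' x = - y" by (simp only: tau_eq_iff[OF det_nonzero])
    then have "tau A d' x - pt (Suc n) = - b" using y' by simp
    then have "d' = d" using uniq i lattice_minus by metis
    then show "y = - tau A d x" using tau by simp
  qed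
  with d show thesis by (intro that[of d]) simp_all
qed

definition R_word :: "real^'d \<Rightarrow> nat \<Rightarrow> real^'d" where
  "R_word y n = (R ^^ n) y - AT A *v (R ^^ Suc n) y"

context
  fixes y :: "real^'d" and j :: nat
  assumes start: "- y - pt j \<in> lattice"
begin

lemma R_funpow_coset: "- (R ^^ n) y - pt (j + n) \<in> lattice"
proof (induction n)
  case (Suc n)
  then show ?case by (rule R_step) simp
qed (simp add: start)

lemma R_word_digit: "R_word y n \<in> D"
  and tau_R_word: "tau A (R_word y n) (- (R ^^ n) y) = - (R ^^ Suc n) y"
proof -
  obtain d where d: "d \<in> D" "tau A d (- (R ^^ n) y) = - (R ^^ Suc n) y"
    by (rule R_step[OF R_funpow_coset[of n]]) simp
  then have "AT A *v (- (R ^^ Suc n) y) = - (R ^^ n) y + d"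
    by (simp only: tau_eq_iff[OF det_nonzero])
  then have "R_word y n = d" unfolding R_word_def by (simp add: vec.neg algebra_simps)
  with d show "R_word y n \<in> D" "tau A (R_word y n) (- (R ^^ n) y) = - (R ^^ Suc n) y"
    by simp_all
qed

lemma R_word_infinite: "R_word y \<in> infinite_words D"
  by (simp add: infinite_words_def R_word_digit)

lemma word_orbit_R_word: "word_orbit A (R_word y) (- y) n = - (R ^^ n) y"
proof (induction n)
  case (Suc n)
  then show ?case using tau_R_word[of n] by simp
qed simp

lemma follows_R_word: "follows (R_word y) (- y) j"
  unfolding follows_def word_orbit_R_word using R_funpow_coset by blast

text \<open>
  The orbit is bounded and lies in finitely many lattice cosets, so it takes only finitely many
  values; being generated by iterating one map, it is periodic from the first repeated value on.
  The period is taken from time \<open>a + 1\<close> and not from \<open>a\<close>, because a word in \<^const>\<open>Omega_cycle\<close> has at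
  least one letter before its periodic tail.
\<close>

lemma R_word_eventually_cyclic:
  "\<exists>C'. cycle_set A D C' \<and> C' \<subseteq> minus_lattice (set \<theta>) \<inter> attractor A D \<and>
     R_word y \<in> Omega_cycle A D C'"
proof -
  let ?u = "\<lambda>n. - (R ^^ n) y"
  obtain r where r: "\<And>n. norm (?u n) \<le> r"
    using word_orbit_bounded[OF expansive finite_digits R_word_infinite, of "- y"]
    unfolding word_orbit_R_word by blast
  have in_coset: "?u n \<in> minus_lattice (set \<theta>)" for n
    unfolding minus_lattice_iff using R_funpow_coset by blast
  have "range ?u \<subseteq> {x \<in> minus_lattice (set \<theta>). norm x \<le> r}"
    using r in_coset by blast
  then have "finite (range ?u)"
    by (rule finite_subset) (simp add: finite_minus_lattice_ball)
  then have "\<not> inj ?u" using finite_imageD infinite_UNIV_nat by blast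
  then obtain a b where ab: "a < b" "(R ^^ a) y = (R ^^ b) y"
    unfolding inj_def by (metis neg_equal_iff_equal linorder_neqE_nat)
  define q s where "q = b - a" and "s = Suc a"
  have "q > 0" using ab by (simp add: q_def)
  have "(R ^^ q) ((R ^^ a) y) = (R ^^ (q + a)) y" by (simp only: funpow_add o_apply)
  then have "(R ^^ q) ((R ^^ a) y) = (R ^^ a) y" using ab by (simp add: q_def)
  then have "(R ^^ q) ((R ^^ s) y) = (R ^^ s) y"
    by (simp add: s_def funpow_swap1[symmetric])
  then have "(R ^^ (i mod q)) ((R ^^ s) y) = (R ^^ i) ((R ^^ s) y)" for i
    by (rule funpow_mod_eq)
  then have per: "(R ^^ (s + i mod q)) y = (R ^^ (s + i)) y" for i
    by (simp add: add.commute[of s] funpow_add)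
  define \<eta> m where "\<eta> = map (\<lambda>i. ?u (s + i)) [0..<q]" and "m = map (\<lambda>i. R_word y (s + i)) [0..<q]"
  have cyc: "cycle_list A D \<eta> m"
    unfolding cycle_list_def
  proof (intro conjI allI impI)
    show "\<eta> \<noteq> []" "length m = length \<eta>" "set m \<subseteq> D"
      using \<open>q > 0\<close> R_word_digit by (auto simp: \<eta>_def m_def)
    fix i assume "i < length \<eta>"
    then have i: "i < q" by (simp add: \<eta>_def)
    have "tau A (m ! i) (\<eta> ! i) = ?u (Suc (s + i))"
      using i tau_R_word[of "s + i"] by (simp add: \<eta>_def m_def)
    also have "\<dots> = ?u (s + Suc i mod q)" using per[of "Suc i"] by simp
    also have "\<dots> = \<eta> ! (Suc i mod length \<eta>)" using \<open>q > 0\<close> by (simp add: \<eta>_def)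
    finally show "tau A (m ! i) (\<eta> ! i) = \<eta> ! (Suc i mod length \<eta>)" .
  qed
  have "R_word y (Suc a + i) = m ! (i mod length m)" for i
  proof -
    have "m ! (i mod length m) = R_word y (s + i mod q)" using \<open>q > 0\<close> by (simp add: m_def)
    also have "\<dots> = R_word y (s + i)"
      unfolding R_word_def using per[of i] by simp
    finally show ?thesis by (simp add: s_def)
  qed
  then have "R_word y \<in> Omega_cycle A D (set \<eta>)"
    unfolding Omega_cycle_def associated_def using R_word_infinite cyc by blast
  moreover have "set \<eta> \<subseteq> minus_lattice (set \<theta>)" using in_coset by (auto simp: \<eta>_def)
  moreover have "set \<eta> \<subseteq> attractor A D" by (rule cycle_subset_attractor[OF expansive cyc])
  moreover have "cycle_set A D (set \<eta>)" using cyc by (auto simp: cycle_set_def associated_def)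
  ultimately show ?thesis by blast
qed

end

section \<open>Words with a cyclic tail\<close>

text \<open>
  At time \<open>N\<close> the orbit enters the cycle. From there on it stays in \<open>C - \<int>\<^sup>d\<close>, and by simplicity it
  visits the cosets in their cyclic order: pulling back the coset of the next point must give the
  coset of the present one. Before time \<open>N\<close> the cosets follow by pulling back.
\<close>

lemma follows_eventually_cyclic:
  assumes \<omega>: "\<omega> \<in> infinite_words D" and cyc: "cycle_list A D \<eta> m"
    and sub: "set \<eta> \<subseteq> minus_lattice (set \<theta>)"
    and tail: "\<And>i. \<omega> (N + i) = m ! (i mod length m)"
    and start: "\<eta> ! 0 - pt (j + N) \<in> lattice"
  shows "follows \<omega> (AT_pow A N (\<eta> ! 0) - (\<Sum>i<N. AT_pow A i (\<omega> i))) j"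
proof -
  define x where "x = AT_pow A N (\<eta> ! 0) - (\<Sum>i<N. AT_pow A i (\<omega> i))"
  let ?o = "word_orbit A \<omega> x"
  have digit: "\<omega> n \<in> lattice" for n using \<omega> digits_lattice by (auto simp: infinite_words_def)
  have AT_orbit: "AT A *v ?o (Suc n) = ?o n + \<omega> n" for n
    using tau_eq_iff[OF det_nonzero] by (metis word_orbit_Suc)
  have "AT_pow A N (?o N) = AT_pow A N (\<eta> ! 0)"
    by (simp add: AT_pow_word_orbit[OF det_nonzero] x_def)
  then have N: "?o N = \<eta> ! 0" by (rule AT_pow_inj[OF det_nonzero])
  have later: "?o (N + i) = \<eta> ! (i mod length \<eta>)" for i
  proof -
    have "?o (N + i) = word_orbit A (\<lambda>i. m ! (i mod length m)) (\<eta> ! 0) i"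
      by (induction i) (simp_all add: N tail)
    then show ?thesis by (simp only: word_orbit_cycle[OF cyc])
  qed
  have after: "?o (N + i) - pt (j + (N + i)) \<in> lattice" for i
  proof (induction i)
    case (Suc i)
    have "length \<eta> > 0" using cyc by (auto simp: cycle_list_def)
    then have "?o (Suc (N + i)) \<in> minus_lattice (set \<theta>)"
      using sub later[of "Suc i"] by (metis add_Suc_right mod_less_divisor nth_mem subsetD)
    then obtain n where n: "?o (Suc (N + i)) - pt n \<in> lattice" by (auto simp: minus_lattice_iff)
    \<comment> \<open>\<open>n + (p - 1)\<close> is the predecessor of \<open>n\<close> in the cyclic order, also for \<open>n = 0\<close>.\<close>
    have "pt n = pt (n + p)" by (simp add: pt_def)
    also have "n + p = Suc (n + (p - 1))" using p_pos by simp
    finally have period: "pt n = pt (Suc (n + (p - 1)))" .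
    with n have "?o (N + i) - pt (n + (p - 1)) \<in> lattice"
      using coset_pull_back[OF digit AT_orbit] by metis
    then have "(n + (p - 1)) mod p = (j + (N + i)) mod p"
      using coset_index_iff[OF Suc.IH] by metis
    then have "pt (Suc (n + (p - 1))) = pt (Suc (j + (N + i)))"
      by (intro pt_cong) (metis mod_Suc_eq)
    then show ?case using n period by simp
  qed (use N start in simp)
  have "?o n - pt (j + n) \<in> lattice" if "n \<le> N" for n
    using that
  proof (induction n rule: inc_induct)
    case base
    then show ?case using after[of 0] by simp
  next
    case (step n)
    then show ?case using coset_pull_back[OF digit AT_orbit] by (metis add_Suc_right)
  qed
  then show ?thesis
    unfolding follows_def x_def[symmetric] using after by (metis le_add_diff_inverse nat_le_linear)
qed


lemma encode_eq:
  assumes "j < p" "\<omega> \<in> infinite_words D" "follows \<omega> (\<theta> ! j - k) j"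
  shows "encode A D \<theta> (k, j) = \<omega>"
  unfolding encode_def case_prod_conv word_path_eq_iff[OF assms(1)]
  using assms follows_word_unique by (intro the_equality) blast+

lemma decode_eq:
  assumes "k \<in> lattice" "j < p" "follows \<omega> (\<theta> ! j - k) j"
  shows "decode A \<theta> \<omega> = (k, j)"
  unfolding decode_def
proof (rule the_equality)
  fix kj :: "(real^'d) \<times> nat"
  assume "case kj of (k, j) \<Rightarrow> k \<in> lattice \<and> j < p \<and>
     (\<forall>x. word_path A \<omega> x = i_hat_cycle A \<theta> (x + k - \<theta> ! j) j)"
  then show "kj = (k, j)"
    using assms follows_unique by (cases kj) (auto simp: word_path_eq_iff)
qed (use assms in \<open>simp add: word_path_eq_iff\<close>)

lemma encode_R_word:
  assumes "k \<in> lattice" "j < p"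
  shows "R_word (k - \<theta> ! j) \<in> infinite_words D"
    and "follows (R_word (k - \<theta> ! j)) (\<theta> ! j - k) j"
    and "encode A D \<theta> (k, j) = R_word (k - \<theta> ! j)"
    and "\<exists>C'. cycle_set A D C' \<and> C' \<subseteq> minus_lattice (set \<theta>) \<inter> attractor A D \<and>
           R_word (k - \<theta> ! j) \<in> Omega_cycle A D C'"
proof -
  let ?y = "k - \<theta> ! j"
  have start: "- ?y - pt j \<in> lattice" using assms lattice_minus by (simp add: pt_nth)
  show w: "R_word ?y \<in> infinite_words D" by (rule R_word_infinite[OF start])
  show f: "follows (R_word ?y) (\<theta> ! j - k) j" using follows_R_word[OF start] by simp
  show "encode A D \<theta> (k, j) = R_word ?y" by (rule encode_eq[OF assms(2) w f])
  show "\<exists>C'. cycle_set A D C' \<and> C' \<subseteq> minus_lattice (set \<theta>) \<inter> attractor A D \<and>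
           R_word ?y \<in> Omega_cycle A D C'"
    by (rule R_word_eventually_cyclic[OF start])
qed

lemma cyclic_tail_start:
  assumes \<omega>: "\<omega> \<in> infinite_words D" and cyc: "cycle_list A D \<eta> m"
    and sub: "set \<eta> \<subseteq> minus_lattice (set \<theta>)"
    and tail: "\<And>i. \<omega> (N + i) = m ! (i mod length m)"
    and j: "j < p" and start: "\<eta> ! 0 - pt (j + N) \<in> lattice"
  defines "k \<equiv> (\<Sum>i<N. AT_pow A i (\<omega> i)) + \<theta> ! j - AT_pow A N (\<eta> ! 0)"
  shows "k \<in> lattice" and "follows \<omega> (\<theta> ! j - k) j"
proof -
  have "\<theta> ! j - k = AT_pow A N (\<eta> ! 0) - (\<Sum>i<N. AT_pow A i (\<omega> i))" by (simp add: k_def)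
  with follows_eventually_cyclic[OF \<omega> cyc sub tail start]
  show f: "follows \<omega> (\<theta> ! j - k) j" by simp
  have "word_orbit A \<omega> (\<theta> ! j - k) 0 - pt (j + 0) \<in> lattice"
    using f unfolding follows_def by blast
  then have "- k \<in> lattice" using j by (simp add: pt_nth)
  then show "k \<in> lattice" using lattice_minus by fastforce
qed

text \<open>
  If the point \<open>\<eta>\<^sub>0\<close> where the periodic tail begins lies in the coset of \<open>\<theta>\<^sub>l\<close>, then \<open>j \<equiv> l - N\<close>
  modulo \<open>p\<close>. This is written as \<open>l + (p - 1) N\<close> to avoid truncated subtraction.
\<close>

lemma Omega_cycle_start:
  assumes sub: "C' \<subseteq> minus_lattice (set \<theta>)" and \<omega>: "\<omega> \<in> Omega_cycle A D C'"
  obtains k j where "k \<in> lattice" "j < p" "follows \<omega> (\<theta> ! j - k) j"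
proof -
  obtain m n \<eta> where word: "\<omega> \<in> infinite_words D" and \<eta>: "set \<eta> = C'" "cycle_list A D \<eta> m"
    and tail: "\<And>i. \<omega> (Suc n + i) = m ! (i mod length m)"
    using \<omega> unfolding Omega_cycle_def associated_def by blast
  have "\<eta> ! 0 \<in> C'" using \<eta> by (auto simp: cycle_list_def)
  then have "\<eta> ! 0 \<in> minus_lattice (set \<theta>)" using sub by blast
  then obtain l where l: "\<eta> ! 0 - pt l \<in> lattice" unfolding minus_lattice_iff by blast
  define N j where "N = Suc n" and "j = (l + (p - 1) * N) mod p"
  have "l + (p - 1) * N + N = l + p * N" using p_pos by (cases p) simp_all
  then have "(j + N) mod p = (l + p * N) mod p" by (metis j_def mod_add_left_eq)
  then have "pt (j + N) = pt l" by (intro pt_cong) simp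
  then have start: "\<eta> ! 0 - pt (j + N) \<in> lattice" using l by simp
  have j: "j < p" using p_pos by (simp add: j_def)
  have sub': "set \<eta> \<subseteq> minus_lattice (set \<theta>)" using sub \<eta>(1) by simp
  have tail': "\<omega> (N + i) = m ! (i mod length m)" for i using tail by (simp only: N_def)
  show thesis
    by (rule that[OF _ j]) (rule cyclic_tail_start[OF word \<eta>(2) sub' tail' j start])+
qed

lemma encode_decode_inverse:
  assumes "\<omega> \<in> Omega_tilde A D \<theta>"
  shows "decode A \<theta> \<omega> \<in> lattice \<times> {..<p}" and "encode A D \<theta> (decode A \<theta> \<omega>) = \<omega>"
proof -
  obtain C' where C': "C' \<subseteq> minus_lattice (set \<theta>)" "\<omega> \<in> Omega_cycle A D C'"
    using assms unfolding Omega_tilde_def by blast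
  then obtain k j where kj: "k \<in> lattice" "j < p" "follows \<omega> (\<theta> ! j - k) j"
    by (rule Omega_cycle_start)
  have "\<omega> \<in> infinite_words D" using C'(2) by (simp add: Omega_cycle_def)
  with kj show "decode A \<theta> \<omega> \<in> lattice \<times> {..<p}" "encode A D \<theta> (decode A \<theta> \<omega>) = \<omega>"
    by (simp_all add: decode_eq encode_eq)
qed

text \<open>
  A prefix of length \<open>n p\<close> runs through full periods of the cycle, so \<open>\<eta>\<close> lies in the coset of
  \<open>\<theta>\<^sub>j\<close> itself, without a shift of the index.
\<close>

lemma decode_cyclic_tail:
  assumes sub: "C' \<subseteq> minus_lattice (set \<theta>)" and assoc: "associated A D C' m"
    and \<omega>: "\<omega> \<in> Omega_cycle A D C'" and tail: "\<forall>i. \<omega> (n * p + i) = m ! (i mod length m)"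
  shows "\<exists>!\<eta>. fold (tau A) m \<eta> = \<eta>"
    and "\<And>\<eta>. fold (tau A) m \<eta> = \<eta> \<Longrightarrow> (\<exists>!j. j < p \<and> \<eta> \<in> minus_lattice {\<theta> ! j}) \<and>
           (case decode A \<theta> \<omega> of (k, j) \<Rightarrow>
              j < p \<and> \<eta> \<in> minus_lattice {\<theta> ! j} \<and>
              k = (\<Sum>i<n * p. AT_pow A i (\<omega> i)) + \<theta> ! j - AT_pow A (n * p) \<eta>)"
proof -
  obtain \<zeta> where \<zeta>: "set \<zeta> = C'" "cycle_list A D \<zeta> m" using assoc unfolding associated_def by blast
  have "m \<noteq> []" using \<zeta> by (auto simp: cycle_list_def)
  have fixed: "fold (tau A) m \<eta> = \<eta> \<longleftrightarrow> \<eta> = \<zeta> ! 0" for \<eta>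
    using fold_tau_fixed_point_unique[OF expansive \<open>m \<noteq> []\<close>] fold_tau_cycle[OF \<zeta>(2)] by blast
  then show "\<exists>!\<eta>. fold (tau A) m \<eta> = \<eta>" by simp
  fix \<eta> assume "fold (tau A) m \<eta> = \<eta>"
  then have \<eta>: "\<eta> = \<zeta> ! 0" using fixed by blast
  then have "\<eta> \<in> C'" using \<zeta> by (auto simp: cycle_list_def)
  then have "\<eta> \<in> minus_lattice (set \<theta>)" using sub by blast
  then obtain l where l: "\<eta> - pt l \<in> lattice" unfolding minus_lattice_iff by blast
  define j where "j = l mod p"
  have j: "j < p" using p_pos by (simp add: j_def)
  have mem: "i < p \<Longrightarrow> \<eta> \<in> minus_lattice {\<theta> ! i} \<longleftrightarrow> i = j" for i
    using coset_index_iff[OF l, of i] by (auto simp: minus_lattice_nth_iff j_def)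
  have "pt (j + n * p) = pt l" by (intro pt_cong) (simp add: j_def)
  then have start: "\<zeta> ! 0 - pt (j + n * p) \<in> lattice" using l \<eta> by simp
  have "\<omega> \<in> infinite_words D" using \<omega> by (simp add: Omega_cycle_def)
  note k = cyclic_tail_start[OF this \<zeta>(2) _ _ j start]
  have "decode A \<theta> \<omega> = ((\<Sum>i<n * p. AT_pow A i (\<omega> i)) + \<theta> ! j - AT_pow A (n * p) (\<zeta> ! 0), j)"
    by (rule decode_eq[OF _ j]; rule k) (use sub \<zeta> tail in simp_all)
  with \<eta> mem j show "(\<exists>!j. j < p \<and> \<eta> \<in> minus_lattice {\<theta> ! j}) \<and>
      (case decode A \<theta> \<omega> of (k, j) \<Rightarrow> j < p \<and> \<eta> \<in> minus_lattice {\<theta> ! j} \<and>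
         k = (\<Sum>i<n * p. AT_pow A i (\<omega> i)) + \<theta> ! j - AT_pow A (n * p) \<eta>)"
    by auto
qed

end

theorem theorem6p15:
  fixes A :: "int^'d^'d" and D :: "(real^'d) set" and \<theta> :: "(real^'d) list" and p :: nat
  assumes "expansive A"
    and "complete_reps A D"
    and "simple_cycle A D \<theta>"
    and "p = length \<theta>"
  shows
    \<comment> \<open>(i)\<close>
    "(\<forall>k\<in>lattice. \<forall>j<p.
        (\<exists>!\<omega>. \<omega> \<in> infinite_words D \<and>
           (\<forall>x. word_path A \<omega> x = i_hat_cycle A \<theta> (x + k - \<theta> ! j) j)) \<and>
        (\<forall>x. i_hat_cycle A \<theta> (x + k - \<theta> ! j) j
               = solenoid_mult ((sigma_inv A ^^ j) (chi_cycle \<theta>)) (i_hat A (x + k - \<theta> ! j)) \<and>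
             i_hat_cycle A \<theta> (x + k - \<theta> ! j) j
               = (\<lambda>n. torus_exp (AT_inv_pow A n (x + k - \<theta> ! j) + \<theta> ! ((j + n) mod p)))) \<and>
        (\<exists>C'. cycle_set A D C' \<and> C' \<subseteq> minus_lattice (set \<theta>) \<inter> attractor A D \<and>
              encode A D \<theta> (k, j) \<in> Omega_cycle A D C'))
     \<and>
     (\<comment> \<open>(ii)\<close>
      \<forall>k\<in>lattice. \<forall>j<p. \<forall>n.
        encode A D \<theta> (k, j) n
          = (R_cycle A D \<theta> ^^ n) (k - \<theta> ! j)
              - AT A *v (R_cycle A D \<theta> ^^ Suc n) (k - \<theta> ! j))
     \<and>
     (\<comment> \<open>(iii)\<close>
      \<forall>C' \<omega>. cycle_set A D C' \<and> C' \<subseteq> minus_lattice (set \<theta>) \<inter> attractor A D \<and>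
             \<omega> \<in> Omega_cycle A D C' \<longrightarrow>
        (\<exists>!kj. case kj of (k, j) \<Rightarrow> k \<in> lattice \<and> j < p \<and>
           (\<forall>x. word_path A \<omega> x = i_hat_cycle A \<theta> (x + k - \<theta> ! j) j)))
     \<and>
     (\<comment> \<open>(iv)\<close>
      \<forall>C' \<omega> m n. C' \<subseteq> minus_lattice (set \<theta>) \<inter> attractor A D \<and> associated A D C' m \<and>
             \<omega> \<in> Omega_cycle A D C' \<and> (\<forall>i. \<omega> (n * p + i) = m ! (i mod length m)) \<longrightarrow>
        (\<exists>!\<eta>. fold (tau A) m \<eta> = \<eta>) \<and>
        (\<forall>\<eta>. fold (tau A) m \<eta> = \<eta> \<longrightarrow>
           (\<exists>!j. j < p \<and> \<eta> \<in> minus_lattice {\<theta> ! j}) \<and>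
           (case decode A \<theta> \<omega> of (k, j) \<Rightarrow>
              j < p \<and> \<eta> \<in> minus_lattice {\<theta> ! j} \<and>
              k = (\<Sum>i<n * p. AT_pow A i (\<omega> i)) + \<theta> ! j - AT_pow A (n * p) \<eta>)))
     \<and>
     (\<comment> \<open>(v)\<close>
      encode A D \<theta> \<in> lattice \<times> {..<p} \<rightarrow> Omega_tilde A D \<theta> \<and>
      decode A \<theta> \<in> Omega_tilde A D \<theta> \<rightarrow> lattice \<times> {..<p} \<and>
      (\<forall>kj\<in>lattice \<times> {..<p}. decode A \<theta> (encode A D \<theta> kj) = kj) \<and>
      (\<forall>\<omega>\<in>Omega_tilde A D \<theta>. encode A D \<theta> (decode A \<theta> \<omega>) = \<omega>))"
proof (intro conjI)
  interpret simple_cycle_system A D \<theta>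
    by (rule simple_cycle_system.intro) (rule assms)+
  note p = assms(4)
  show "\<forall>k\<in>lattice. \<forall>j<p.
        (\<exists>!\<omega>. \<omega> \<in> infinite_words D \<and>
           (\<forall>x. word_path A \<omega> x = i_hat_cycle A \<theta> (x + k - \<theta> ! j) j)) \<and>
        (\<forall>x. i_hat_cycle A \<theta> (x + k - \<theta> ! j) j
               = solenoid_mult ((sigma_inv A ^^ j) (chi_cycle \<theta>)) (i_hat A (x + k - \<theta> ! j)) \<and>
             i_hat_cycle A \<theta> (x + k - \<theta> ! j) j
               = (\<lambda>n. torus_exp (AT_inv_pow A n (x + k - \<theta> ! j) + \<theta> ! ((j + n) mod p)))) \<and>
        (\<exists>C'. cycle_set A D C' \<and> C' \<subseteq> minus_lattice (set \<theta>) \<inter> attractor A D \<and>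
              encode A D \<theta> (k, j) \<in> Omega_cycle A D C')"
    (is "\<forall>k\<in>lattice. \<forall>j<p. ?word k j \<and> ?path k j \<and> ?cycle k j")
  proof (intro ballI allI impI conjI)
    fix k :: "real^'d" and j assume k: "k \<in> lattice" and "j < p"
    then have j: "j < length \<theta>" by (simp add: p)
    show "?word k j"
      unfolding word_path_eq_iff[OF j] using encode_R_word[OF k j] follows_word_unique by blast
    show "?cycle k j" using encode_R_word[OF k j] by simp
    fix x
    show "i_hat_cycle A \<theta> (x + k - \<theta> ! j) j
        = solenoid_mult ((sigma_inv A ^^ j) (chi_cycle \<theta>)) (i_hat A (x + k - \<theta> ! j))"
      by (rule i_hat_cycle_def)
    show "i_hat_cycle A \<theta> (x + k - \<theta> ! j) j
        = (\<lambda>n. torus_exp (AT_inv_pow A n (x + k - \<theta> ! j) + \<theta> ! ((j + n) mod p)))"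
      unfolding p by (rule ext) (simp only: i_hat_cycle_eq pt_def)
  qed
  show "\<forall>k\<in>lattice. \<forall>j<p. \<forall>n.
        encode A D \<theta> (k, j) n
          = (R_cycle A D \<theta> ^^ n) (k - \<theta> ! j)
              - AT A *v (R_cycle A D \<theta> ^^ Suc n) (k - \<theta> ! j)"
  proof (intro ballI allI impI)
    fix k :: "real^'d" and j n assume "k \<in> lattice" "j < p"
    then have "encode A D \<theta> (k, j) = R_word (k - \<theta> ! j)" unfolding p by (rule encode_R_word)
    then show "encode A D \<theta> (k, j) n
        = (R_cycle A D \<theta> ^^ n) (k - \<theta> ! j) - AT A *v (R_cycle A D \<theta> ^^ Suc n) (k - \<theta> ! j)"
      by (simp only: R_word_def)
  qed
  show "\<forall>C' \<omega>. cycle_set A D C' \<and> C' \<subseteq> minus_lattice (set \<theta>) \<inter> attractor A D \<and>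
             \<omega> \<in> Omega_cycle A D C' \<longrightarrow>
        (\<exists>!kj. case kj of (k, j) \<Rightarrow> k \<in> lattice \<and> j < p \<and>
           (\<forall>x. word_path A \<omega> x = i_hat_cycle A \<theta> (x + k - \<theta> ! j) j))"
  proof (intro allI impI)
    fix C' \<omega>
    assume "cycle_set A D C' \<and> C' \<subseteq> minus_lattice (set \<theta>) \<inter> attractor A D \<and> \<omega> \<in> Omega_cycle A D C'"
    then obtain k j where kj: "k \<in> lattice" "j < length \<theta>" "follows \<omega> (\<theta> ! j - k) j"
      using Omega_cycle_start by blast
    show "\<exists>!kj. case kj of (k, j) \<Rightarrow> k \<in> lattice \<and> j < p \<and>
           (\<forall>x. word_path A \<omega> x = i_hat_cycle A \<theta> (x + k - \<theta> ! j) j)"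
    proof (rule ex1I[of _ "(k, j)"])
      fix kj' :: "(real^'d) \<times> nat"
      assume "case kj' of (k, j) \<Rightarrow> k \<in> lattice \<and> j < p \<and>
         (\<forall>x. word_path A \<omega> x = i_hat_cycle A \<theta> (x + k - \<theta> ! j) j)"
      then show "kj' = (k, j)"
        using kj follows_unique by (cases kj') (auto simp: p word_path_eq_iff)
    qed (use kj in \<open>simp add: p word_path_eq_iff\<close>)
  qed
  show "\<forall>C' \<omega> m n. C' \<subseteq> minus_lattice (set \<theta>) \<inter> attractor A D \<and> associated A D C' m \<and>
             \<omega> \<in> Omega_cycle A D C' \<and> (\<forall>i. \<omega> (n * p + i) = m ! (i mod length m)) \<longrightarrow>
        (\<exists>!\<eta>. fold (tau A) m \<eta> = \<eta>) \<and>
        (\<forall>\<eta>. fold (tau A) m \<eta> = \<eta> \<longrightarrow>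
           (\<exists>!j. j < p \<and> \<eta> \<in> minus_lattice {\<theta> ! j}) \<and>
           (case decode A \<theta> \<omega> of (k, j) \<Rightarrow>
              j < p \<and> \<eta> \<in> minus_lattice {\<theta> ! j} \<and>
              k = (\<Sum>i<n * p. AT_pow A i (\<omega> i)) + \<theta> ! j - AT_pow A (n * p) \<eta>))"
  proof (intro allI impI)
    fix C' \<omega> m n
    assume "C' \<subseteq> minus_lattice (set \<theta>) \<inter> attractor A D \<and> associated A D C' m \<and>
      \<omega> \<in> Omega_cycle A D C' \<and> (\<forall>i. \<omega> (n * p + i) = m ! (i mod length m))"
    then have *: "C' \<subseteq> minus_lattice (set \<theta>)" "associated A D C' m" "\<omega> \<in> Omega_cycle A D C'"
      "\<forall>i. \<omega> (n * length \<theta> + i) = m ! (i mod length m)"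
      by (simp_all add: p)
    show "(\<exists>!\<eta>. fold (tau A) m \<eta> = \<eta>) \<and>
        (\<forall>\<eta>. fold (tau A) m \<eta> = \<eta> \<longrightarrow>
           (\<exists>!j. j < p \<and> \<eta> \<in> minus_lattice {\<theta> ! j}) \<and>
           (case decode A \<theta> \<omega> of (k, j) \<Rightarrow>
              j < p \<and> \<eta> \<in> minus_lattice {\<theta> ! j} \<and>
              k = (\<Sum>i<n * p. AT_pow A i (\<omega> i)) + \<theta> ! j - AT_pow A (n * p) \<eta>))"
      unfolding p
      by (rule conjI, rule decode_cyclic_tail(1)[OF *], intro allI impI, rule decode_cyclic_tail(2)[OF *])
  qed
  show "encode A D \<theta> \<in> lattice \<times> {..<p} \<rightarrow> Omega_tilde A D \<theta>"
    using encode_R_word unfolding p Omega_tilde_def by fastforce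
  show "decode A \<theta> \<in> Omega_tilde A D \<theta> \<rightarrow> lattice \<times> {..<p}"
    using encode_decode_inverse(1) unfolding p by blast
  show "\<forall>kj\<in>lattice \<times> {..<p}. decode A \<theta> (encode A D \<theta> kj) = kj"
    using encode_R_word by (auto simp: p intro!: decode_eq)
  show "\<forall>\<omega>\<in>Omega_tilde A D \<theta>. encode A D \<theta> (decode A \<theta> \<omega>) = \<omega>"
    using encode_decode_inverse(2) by blast
qed

end
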